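(* Consider the Sturm--Liouville operator $\widetilde{\mathbf L}(\widetilde\vartheta+t\vartheta)$ with fixed $\widetilde\vartheta,\vartheta\in\mathcal M$, $\det\vartheta\ne0$. Then every $\lambda\in\rho(\mathbf L_\infty)$ is an eigenvalue of $\widetilde{\mathbf L}(\widetilde\vartheta+t\vartheta)$ for at most two values of $t\in\mathbb R$.
   Context: Setting. Let $-\infty\le a<b\le\infty$, let $p,w>0$ a.e. and $q$ real-valued a.e. on $(a,b)$ with $1/p,q,w\in L^1_{\rm loc}((a,b),dx)$, and put $\ell[f]=-\frac1w\big((pf')'+qf\big)$, acting in $L^2[(a,b),w]$ with $\langle f,g\rangle=\int_a^b f\overline g\,w\,dx$. Let $\mathcal D_{\max}=\{f: f,pf'\in AC_{\rm loc}(a,b),\ f,\ell[f]\in L^2[(a,b),w]\}$ and $[f,g](x)=p(x)\big(f(x)\overline{g'(x)}-f'(x)\overline{g(x)}\big)$; for $f,g\in\mathcal D_{\max}$ the limits at the endpoints exist. Let $\mathcal D_{\min}=\{f\in\mathcal D_{\max}:[f,g](b)-[f,g](a)=0\ \forall g\in\mathcal D_{\max}\}$, and let $\mathbf L_{\max},\mathbf L_{\min}$ be $\ell$ with domains $\mathcal D_{\max},\mathcal D_{\min}$. Standing assumptions: both endpoints are limit-circle, and $\mathbf L_{\min}$ is semi-bounded from below with lower bound $K\in\mathbb R$ (so the endpoints are non-oscillating). Quasi-derivatives. Fix $\lambda_0\in\mathbb R$. A real solution $u$ of $(\ell-\lambda_0)y=0$ is principal (non-principal) at an endpoint if $1/(pu^2)$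 is not integrable (is integrable) there. Let $u_a,v_a$ (resp. $u_b,v_b$) be real principal and non-principal solutions of $(\ell-\lambda_0)y=0$ at $a$ (resp. $b$) with $[u_a,v_a](a)=1$, $[u_b,v_b](b)=1$. For $f\in\mathcal D_{\max}$: $f^{[0]}(a)=[f,v_a](a)$, $f^{[1]}(a)=-[f,u_a](a)$, $f^{[0]}(b)=[f,v_b](b)$, $f^{[1]}(b)=-[f,u_b](b)$. Extensions. $\Gamma_0'f=(-f^{[1]}(a),f^{[1]}(b))^T$, $\Gamma_1'f=(f^{[0]}(a),f^{[0]}(b))^T$. $\mathbf L_\infty$ is the restriction of $\mathbf L_{\max}$ to $\{f\in\mathcal D_{\max}: f^{[1]}(a)=f^{[1]}(b)=0\}$ and $\rho(\mathbf L_\infty)$ its resolvent set. $\mathcal M$ is the set of Hermitian $2\times2$ matrices; for $\vartheta\in\mathcal M$, $\widetilde{\mathbf L}(\vartheta)$ is the self-adjoint restriction of $\mathbf L_{\max}$ to $\{f\in\mathcal D_{\max}:\vartheta\Gamma_0'f=\Gamma_1'f\}$. *)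

theory Defs
  imports "HOL-Analysis.Analysis"
begin

section \<open>The differential expression\<close>

record sl_data =
  left_end :: ereal
  right_end :: ereal
  coeff_p :: "real \<Rightarrow> real"
  coeff_q :: "real \<Rightarrow> real"
  coeff_w :: "real \<Rightarrow> real"

abbreviation dom_interval :: "sl_data \<Rightarrow> real set" where
  "dom_interval S \<equiv> einterval (left_end S) (right_end S)"

definition ae_on :: "real set \<Rightarrow> (real \<Rightarrow> bool) \<Rightarrow> bool" where
  "ae_on I P \<longleftrightarrow> (AE x in lebesgue. x \<in> I \<longrightarrow> P x)"

definition L1_loc :: "ereal \<Rightarrow> ereal \<Rightarrow> (real \<Rightarrow> real) \<Rightarrow> bool" where
  "L1_loc a b f \<longleftrightarrow>
     (\<forall>c d. a < ereal c \<and> c \<le> d \<and> ereal d < b \<longrightarrow> f absolutely_integrable_on {c..d})"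

definition sl_coefficients :: "sl_data \<Rightarrow> bool" where
  "sl_coefficients S \<longleftrightarrow>
     left_end S < right_end S \<and>
     ae_on (dom_interval S) (\<lambda>x. coeff_p S x > 0) \<and>
     ae_on (dom_interval S) (\<lambda>x. coeff_w S x > 0) \<and>
     L1_loc (left_end S) (right_end S) (\<lambda>x. 1 / coeff_p S x) \<and>
     L1_loc (left_end S) (right_end S) (coeff_q S) \<and>
     L1_loc (left_end S) (right_end S) (coeff_w S)"

text \<open>The \<open>\<epsilon>\<close>-\<open>\<delta>\<close> definition of absolute continuity; \<open>\<D>\<close> ranges over the finite families
  of non-overlapping compact subintervals of \<open>[c, d]\<close>.\<close>

definition abs_cont_on :: "real \<Rightarrow> real \<Rightarrow> (real \<Rightarrow> complex) \<Rightarrow> bool" where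
  "abs_cont_on c d f \<longleftrightarrow>
     (\<forall>\<epsilon>>0. \<exists>\<delta>>0. \<forall>\<D>. \<D> division_of \<Union>\<D> \<and> \<Union>\<D> \<subseteq> {c..d} \<and> (\<Sum>J\<in>\<D>. Sup J - Inf J) < \<delta>
        \<longrightarrow> (\<Sum>J\<in>\<D>. norm (f (Sup J) - f (Inf J))) < \<epsilon>)"

definition AC_loc :: "ereal \<Rightarrow> ereal \<Rightarrow> (real \<Rightarrow> complex) \<Rightarrow> bool" where
  "AC_loc a b f \<longleftrightarrow>
     (\<forall>c d. a < ereal c \<and> c \<le> d \<and> ereal d < b \<longrightarrow> abs_cont_on c d f)"

text \<open>The derivative \<open>f'\<close> exists only almost everywhere, so ``\<open>p f' \<in> AC\<^sub>l\<^sub>o\<^sub>c\<close>'' means that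
  \<open>p f'\<close> agrees almost everywhere with a locally absolutely continuous function \<open>g\<close>.  By
  continuity \<open>g\<close> is unique on the interval; below, every pointwise occurrence of \<open>p f'\<close> denotes
  this representative.  Almost everywhere differentiability of \<open>f\<close> and \<open>g\<close> is a consequence of
  local absolute continuity (Lebesgue's theorem); it is spelt out because
  \<open>vector_derivative\<close> has an unspecified value where the derivative does not exist.\<close>

definition is_pderiv :: "sl_data \<Rightarrow> (real \<Rightarrow> complex) \<Rightarrow> (real \<Rightarrow> complex) \<Rightarrow> bool" where
  "is_pderiv S f g \<longleftrightarrow>
     AC_loc (left_end S) (right_end S) f \<and>
     AC_loc (left_end S) (right_end S) g \<and>
     ae_on (dom_interval S) (\<lambda>x. f differentiable at x \<and> g differentiable at x) \<and>
     ae_on (dom_interval S)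
       (\<lambda>x. g x = complex_of_real (coeff_p S x) * vector_derivative f (at x))"

definition regular_fun :: "sl_data \<Rightarrow> (real \<Rightarrow> complex) \<Rightarrow> bool" where
  "regular_fun S f \<longleftrightarrow> (\<exists>g. is_pderiv S f g)"

definition pderiv_fun :: "sl_data \<Rightarrow> (real \<Rightarrow> complex) \<Rightarrow> real \<Rightarrow> complex" where
  "pderiv_fun S f = (SOME g. is_pderiv S f g)"

definition sl_expr :: "sl_data \<Rightarrow> (real \<Rightarrow> complex) \<Rightarrow> real \<Rightarrow> complex" where
  "sl_expr S f x =
     - (1 / complex_of_real (coeff_w S x)) *
       (vector_derivative (pderiv_fun S f) (at x) + complex_of_real (coeff_q S x) * f x)"

definition sl_solution :: "sl_data \<Rightarrow> complex \<Rightarrow> (real \<Rightarrow> complex) \<Rightarrow> bool" where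
  "sl_solution S z y \<longleftrightarrow>
     regular_fun S y \<and> ae_on (dom_interval S) (\<lambda>x. sl_expr S y x - z * y x = 0)"

section \<open>The weighted Hilbert space\<close>

text \<open>Elements of \<open>L\<^sup>2\<close> are represented by functions; equality in \<open>L\<^sup>2\<close> is equality almost
  everywhere on the interval, and values outside the interval are irrelevant.\<close>

definition sq_integrable_on :: "sl_data \<Rightarrow> real set \<Rightarrow> (real \<Rightarrow> complex) \<Rightarrow> bool" where
  "sq_integrable_on S I f \<longleftrightarrow>
     set_borel_measurable lebesgue I f \<and>
     set_integrable lebesgue I (\<lambda>x. (cmod (f x))\<^sup>2 * coeff_w S x)"

definition L2 :: "sl_data \<Rightarrow> (real \<Rightarrow> complex) set" where
  "L2 S = {f. sq_integrable_on S (dom_interval S) f}"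

definition L2_inner :: "sl_data \<Rightarrow> (real \<Rightarrow> complex) \<Rightarrow> (real \<Rightarrow> complex) \<Rightarrow> complex" where
  "L2_inner S f g =
     (LINT x:dom_interval S|lebesgue. f x * cnj (g x) * complex_of_real (coeff_w S x))"

definition L2_norm :: "sl_data \<Rightarrow> (real \<Rightarrow> complex) \<Rightarrow> real" where
  "L2_norm S f = sqrt (Re (L2_inner S f f))"

section \<open>Maximal and minimal operators\<close>

definition D_max :: "sl_data \<Rightarrow> (real \<Rightarrow> complex) set" where
  "D_max S = {f. regular_fun S f \<and> f \<in> L2 S \<and> sl_expr S f \<in> L2 S}"

definition bracket :: "sl_data \<Rightarrow> (real \<Rightarrow> complex) \<Rightarrow> (real \<Rightarrow> complex) \<Rightarrow> real \<Rightarrow> complex" where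
  "bracket S f g x = f x * cnj (pderiv_fun S g x) - pderiv_fun S f x * cnj (g x)"

text \<open>One-sided limits at the possibly infinite endpoints; for an infinite endpoint the filters
  are \<open>at_bot\<close> and \<open>at_top\<close>.\<close>

definition bracket_left :: "sl_data \<Rightarrow> (real \<Rightarrow> complex) \<Rightarrow> (real \<Rightarrow> complex) \<Rightarrow> complex" where
  "bracket_left S f g = Lim (filtermap real_of_ereal (at_right (left_end S))) (bracket S f g)"

definition bracket_right :: "sl_data \<Rightarrow> (real \<Rightarrow> complex) \<Rightarrow> (real \<Rightarrow> complex) \<Rightarrow> complex" where
  "bracket_right S f g = Lim (filtermap real_of_ereal (at_left (right_end S))) (bracket S f g)"

definition D_min :: "sl_data \<Rightarrow> (real \<Rightarrow> complex) set" where
  "D_min S = {f \<in> D_max S. \<forall>g \<in> D_max S. bracket_right S f g - bracket_left S f g = 0}"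

definition L_min_bounded_below :: "sl_data \<Rightarrow> real \<Rightarrow> bool" where
  "L_min_bounded_below S K \<longleftrightarrow>
     (\<forall>f \<in> D_min S. Re (L2_inner S (sl_expr S f) f) \<ge> K * Re (L2_inner S f f))"

text \<open>Weyl's limit-circle case: for every complex \<open>z\<close>, all solutions of \<open>(\<ell> - z) y = 0\<close> are
  square integrable near the endpoint.\<close>

definition limit_circle_left :: "sl_data \<Rightarrow> bool" where
  "limit_circle_left S \<longleftrightarrow>
     (\<forall>z y. sl_solution S z y \<longrightarrow>
        (\<exists>c \<in> dom_interval S. sq_integrable_on S (einterval (left_end S) (ereal c)) y))"

definition limit_circle_right :: "sl_data \<Rightarrow> bool" where
  "limit_circle_right S \<longleftrightarrow>
     (\<forall>z y. sl_solution S z y \<longrightarrow>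
        (\<exists>c \<in> dom_interval S. sq_integrable_on S (einterval (ereal c) (right_end S)) y))"

section \<open>Restrictions of the maximal operator\<close>

text \<open>All operators considered are restrictions of the maximal operator, hence are determined by
  their domain \<open>D\<close>, a subset of \<open>D_max S\<close>.\<close>

definition is_eigenvalue :: "sl_data \<Rightarrow> (real \<Rightarrow> complex) set \<Rightarrow> complex \<Rightarrow> bool" where
  "is_eigenvalue S D z \<longleftrightarrow>
     (\<exists>f \<in> D. \<not> ae_on (dom_interval S) (\<lambda>x. f x = 0) \<and>
              ae_on (dom_interval S) (\<lambda>x. sl_expr S f x = z * f x))"

text \<open>The operator minus \<open>z\<close> is a bijection from \<open>D\<close> onto \<open>L\<^sup>2\<close> (modulo null functions) with
  bounded inverse.\<close>

definition resolvent_set :: "sl_data \<Rightarrow> (real \<Rightarrow> complex) set \<Rightarrow> complex set" where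
  "resolvent_set S D = {z.
     (\<forall>f \<in> D. ae_on (dom_interval S) (\<lambda>x. sl_expr S f x - z * f x = 0)
        \<longrightarrow> ae_on (dom_interval S) (\<lambda>x. f x = 0)) \<and>
     (\<forall>h \<in> L2 S. \<exists>f \<in> D. ae_on (dom_interval S) (\<lambda>x. sl_expr S f x - z * f x = h x)) \<and>
     (\<exists>C. \<forall>f \<in> D. L2_norm S f \<le> C * L2_norm S (\<lambda>x. sl_expr S f x - z * f x))}"

section \<open>Principal solutions, quasi-derivatives and boundary maps\<close>

abbreviation cplx :: "(real \<Rightarrow> real) \<Rightarrow> real \<Rightarrow> complex" where
  "cplx u \<equiv> (\<lambda>x. complex_of_real (u x))"

text \<open>The trivial solution is excluded explicitly, since \<open>1 / 0 = 0\<close> would make it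
  non-principal.\<close>

definition real_solution :: "sl_data \<Rightarrow> real \<Rightarrow> (real \<Rightarrow> real) \<Rightarrow> bool" where
  "real_solution S \<mu> u \<longleftrightarrow>
     sl_solution S (complex_of_real \<mu>) (cplx u) \<and> (\<exists>x \<in> dom_interval S. u x \<noteq> 0)"

definition inv_pu2_integrable_left :: "sl_data \<Rightarrow> (real \<Rightarrow> real) \<Rightarrow> bool" where
  "inv_pu2_integrable_left S u \<longleftrightarrow>
     (\<exists>c \<in> dom_interval S.
        set_integrable lebesgue (einterval (left_end S) (ereal c)) (\<lambda>x. 1 / (coeff_p S x * (u x)\<^sup>2)))"

definition inv_pu2_integrable_right :: "sl_data \<Rightarrow> (real \<Rightarrow> real) \<Rightarrow> bool" where
  "inv_pu2_integrable_right S u \<longleftrightarrow>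
     (\<exists>c \<in> dom_interval S.
        set_integrable lebesgue (einterval (ereal c) (right_end S)) (\<lambda>x. 1 / (coeff_p S x * (u x)\<^sup>2)))"

definition principal_left :: "sl_data \<Rightarrow> real \<Rightarrow> (real \<Rightarrow> real) \<Rightarrow> bool" where
  "principal_left S \<mu> u \<longleftrightarrow> real_solution S \<mu> u \<and> \<not> inv_pu2_integrable_left S u"

definition nonprincipal_left :: "sl_data \<Rightarrow> real \<Rightarrow> (real \<Rightarrow> real) \<Rightarrow> bool" where
  "nonprincipal_left S \<mu> u \<longleftrightarrow> real_solution S \<mu> u \<and> inv_pu2_integrable_left S u"

definition principal_right :: "sl_data \<Rightarrow> real \<Rightarrow> (real \<Rightarrow> real) \<Rightarrow> bool" where
  "principal_right S \<mu> u \<longleftrightarrow> real_solution S \<mu> u \<and> \<not> inv_pu2_integrable_right S u"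

definition nonprincipal_right :: "sl_data \<Rightarrow> real \<Rightarrow> (real \<Rightarrow> real) \<Rightarrow> bool" where
  "nonprincipal_right S \<mu> u \<longleftrightarrow> real_solution S \<mu> u \<and> inv_pu2_integrable_right S u"

text \<open>The quasi-derivatives \<open>f\<^bsup>[0]\<^esup>(a)\<close>, \<open>f\<^bsup>[1]\<^esup>(a)\<close>, \<open>f\<^bsup>[0]\<^esup>(b)\<close>, \<open>f\<^bsup>[1]\<^esup>(b)\<close>.\<close>

definition qd0_left :: "sl_data \<Rightarrow> (real \<Rightarrow> real) \<Rightarrow> (real \<Rightarrow> complex) \<Rightarrow> complex" where
  "qd0_left S va f = bracket_left S f (cplx va)"

definition qd1_left :: "sl_data \<Rightarrow> (real \<Rightarrow> real) \<Rightarrow> (real \<Rightarrow> complex) \<Rightarrow> complex" where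
  "qd1_left S ua f = - bracket_left S f (cplx ua)"

definition qd0_right :: "sl_data \<Rightarrow> (real \<Rightarrow> real) \<Rightarrow> (real \<Rightarrow> complex) \<Rightarrow> complex" where
  "qd0_right S vb f = bracket_right S f (cplx vb)"

definition qd1_right :: "sl_data \<Rightarrow> (real \<Rightarrow> real) \<Rightarrow> (real \<Rightarrow> complex) \<Rightarrow> complex" where
  "qd1_right S ub f = - bracket_right S f (cplx ub)"

definition Gamma0' ::
  "sl_data \<Rightarrow> (real \<Rightarrow> real) \<Rightarrow> (real \<Rightarrow> real) \<Rightarrow> (real \<Rightarrow> complex) \<Rightarrow> complex ^ 2" where
  "Gamma0' S ua ub f = vector [- qd1_left S ua f, qd1_right S ub f]"

definition Gamma1' ::
  "sl_data \<Rightarrow> (real \<Rightarrow> real) \<Rightarrow> (real \<Rightarrow> real) \<Rightarrow> (real \<Rightarrow> complex) \<Rightarrow> complex ^ 2" where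
  "Gamma1' S va vb f = vector [qd0_left S va f, qd0_right S vb f]"

definition D_inf ::
  "sl_data \<Rightarrow> (real \<Rightarrow> real) \<Rightarrow> (real \<Rightarrow> real) \<Rightarrow> (real \<Rightarrow> complex) set" where
  "D_inf S ua ub = {f \<in> D_max S. qd1_left S ua f = 0 \<and> qd1_right S ub f = 0}"

definition hermitian_matrices :: "(complex ^ 2 ^ 2) set" where
  "hermitian_matrices = {A. transpose (map_matrix cnj A) = A}"

definition D_ext ::
  "sl_data \<Rightarrow> (real \<Rightarrow> real) \<Rightarrow> (real \<Rightarrow> real) \<Rightarrow> (real \<Rightarrow> real) \<Rightarrow> (real \<Rightarrow> real) \<Rightarrow>
   complex ^ 2 ^ 2 \<Rightarrow> (real \<Rightarrow> complex) set" where
  "D_ext S ua va ub vb \<theta> = {f \<in> D_max S. \<theta> *v Gamma0' S ua ub f = Gamma1' S va vb f}"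

end

theory Submission
  imports Defs
begin

text \<open>On the eigenspace of \<open>\<ell>\<close> at \<open>z\<close> the Lagrange identity and the limit-circle hypothesis make the
  boundary brackets convergent, hence \<open>\<Gamma>\<^sub>0'\<close> and \<open>\<Gamma>\<^sub>1'\<close> are linear there.  Since \<open>z\<close> lies in the
  resolvent set of \<open>L\<^sub>\<infinity>\<close>, \<open>\<Gamma>\<^sub>0' f = 0\<close> forces \<open>f = 0\<close>, so the pairs \<open>(\<Gamma>\<^sub>0' f, \<Gamma>\<^sub>1' f)\<close> form a
  single-valued linear relation, which extends to a matrix \<open>M\<close>; the existence of
  a full set of solutions is not needed.  An eigenfunction for the parameter \<open>t\<close> yields a nonzero
  vector in the kernel of \<open>\<theta>' + t \<theta> - M\<close>, so \<open>t\<close> is a root of a quadratic polynomial with leading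
  coefficient \<open>det \<theta> \<noteq> 0\<close>.\<close>

section \<open>Absolutely continuous functions\<close>

lemma abs_cont_onD:
  assumes "abs_cont_on c d f" "\<epsilon> > 0"
  obtains \<delta> where "\<delta> > 0"
    "\<And>\<D>. \<lbrakk>\<D> division_of \<Union>\<D>; \<Union>\<D> \<subseteq> {c..d}; (\<Sum>J\<in>\<D>. Sup J - Inf J) < \<delta>\<rbrakk>
       \<Longrightarrow> (\<Sum>J\<in>\<D>. norm (f (Sup J) - f (Inf J))) < \<epsilon>"
  using assms unfolding abs_cont_on_def by meson

text \<open>Members of a division are nonempty boxes, so \<open>Inf\<close> and \<open>Sup\<close>
  are their true endpoints rather than the unspecified values at the empty set.\<close>

lemma division_real_intervalE:
  fixes J :: "real set"
  assumes "\<D> division_of A" "J \<in> \<D>"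
  obtains u v where "J = {u..v}" "u \<le> v" "Inf J = u" "Sup J = v" "{u..v} \<subseteq> A"
proof -
  obtain u v where "J = cbox u v" using assms division_ofD(4) by blast
  moreover have "J \<noteq> {}" "J \<subseteq> A" using assms division_ofD(2,3) by blast+
  ultimately show ?thesis using that[of u v] by auto
qed

lemma abs_cont_on_imp_continuous_on:
  assumes "abs_cont_on c d f"
  shows "continuous_on {c..d} f"
  unfolding continuous_on_iff
proof (intro ballI allI impI)
  fix x and \<epsilon> :: real assume x: "x \<in> {c..d}" and e: "\<epsilon> > 0"
  obtain \<delta> where \<delta>: "\<delta> > 0"
    "\<And>\<D>. \<lbrakk>\<D> division_of \<Union>\<D>; \<Union>\<D> \<subseteq> {c..d}; (\<Sum>J\<in>\<D>. Sup J - Inf J) < \<delta>\<rbrakk>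
       \<Longrightarrow> (\<Sum>J\<in>\<D>. norm (f (Sup J) - f (Inf J))) < \<epsilon>"
    by (rule abs_cont_onD[OF assms e]) (erule that, blast)
  \<comment> \<open>A single interval is already a division, so the condition on families contains
    uniform continuity.\<close>
  have *: "norm (f v - f u) < \<epsilon>" if "u \<le> v" "u \<in> {c..d}" "v \<in> {c..d}" "v - u < \<delta>" for u v
    using \<delta>(2)[of "{{u..v}}"] that division_of_self[of u v] by simp
  show "\<exists>\<delta>>0. \<forall>x'\<in>{c..d}. dist x' x < \<delta> \<longrightarrow> dist (f x') (f x) < \<epsilon>"
  proof (intro exI[of _ \<delta>] conjI ballI impI \<delta>(1))
    fix y assume y: "y \<in> {c..d}" "dist y x < \<delta>"
    show "dist (f y) (f x) < \<epsilon>"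
    proof (cases "x \<le> y")
      case True then show ?thesis using *[of x y] x y by (simp add: dist_norm)
    next
      case False then show ?thesis using *[of y x] x y by (simp add: dist_norm norm_minus_commute)
    qed
  qed
qed

text \<open>Common source of the closure properties below: summing the increment bound over a
  division reduces the claim for \<open>h\<close> to those for \<open>f\<close> and
  \<open>g\<close>.\<close>

lemma abs_cont_on_dominated:
  assumes f: "abs_cont_on c d f" and g: "abs_cont_on c d g" and B: "B > 0"
    and h: "\<And>x y. \<lbrakk>x \<in> {c..d}; y \<in> {c..d}\<rbrakk> \<Longrightarrow> norm (h x - h y) \<le> B * (norm (f x - f y) + norm (g x - g y))"
  shows "abs_cont_on c d h"
  unfolding abs_cont_on_def
proof (intro allI impI)
  fix \<epsilon> :: real assume "\<epsilon> > 0"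
  \<comment> \<open>After multiplication by \<open>B\<close>, each of the two sums may use up half
    of \<epsilon>.\<close>
  then have e: "\<epsilon> / (2 * B) > 0" using B by simp
  obtain \<delta> where \<delta>: "\<delta> > 0"
    "\<And>\<D>. \<lbrakk>\<D> division_of \<Union>\<D>; \<Union>\<D> \<subseteq> {c..d}; (\<Sum>J\<in>\<D>. Sup J - Inf J) < \<delta>\<rbrakk>
       \<Longrightarrow> (\<Sum>J\<in>\<D>. norm (f (Sup J) - f (Inf J))) < \<epsilon> / (2 * B)"
    by (rule abs_cont_onD[OF f e]) (erule that, blast)
  obtain \<gamma> where \<gamma>: "\<gamma> > 0"
    "\<And>\<D>. \<lbrakk>\<D> division_of \<Union>\<D>; \<Union>\<D> \<subseteq> {c..d}; (\<Sum>J\<in>\<D>. Sup J - Inf J) < \<gamma>\<rbrakk>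
       \<Longrightarrow> (\<Sum>J\<in>\<D>. norm (g (Sup J) - g (Inf J))) < \<epsilon> / (2 * B)"
    by (rule abs_cont_onD[OF g e]) (erule that, blast)
  show "\<exists>\<delta>>0. \<forall>\<D>. \<D> division_of \<Union>\<D> \<and> \<Union>\<D> \<subseteq> {c..d} \<and> (\<Sum>J\<in>\<D>. Sup J - Inf J) < \<delta>
      \<longrightarrow> (\<Sum>J\<in>\<D>. norm (h (Sup J) - h (Inf J))) < \<epsilon>"
  proof (intro exI[of _ "min \<delta> \<gamma>"] conjI allI impI)
    fix \<D> :: "real set set"
    assume *: "\<D> division_of \<Union>\<D> \<and> \<Union>\<D> \<subseteq> {c..d} \<and> (\<Sum>J\<in>\<D>. Sup J - Inf J) < min \<delta> \<gamma>"
    have "(\<Sum>J\<in>\<D>. norm (h (Sup J) - h (Inf J)))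
        \<le> (\<Sum>J\<in>\<D>. B * (norm (f (Sup J) - f (Inf J)) + norm (g (Sup J) - g (Inf J))))"
    proof (intro sum_mono h)
      fix J assume "J \<in> \<D>"
      then obtain u v where "J = {u..v}" "u \<le> v" "Inf J = u" "Sup J = v" "{u..v} \<subseteq> \<Union>\<D>"
        using * division_real_intervalE by metis
      then show "Sup J \<in> {c..d}" "Inf J \<in> {c..d}"
        using * subset_trans[of "{u..v}" "\<Union>\<D>" "{c..d}"] by (simp_all add: subset_iff)
    qed
    also have "\<dots> = B * ((\<Sum>J\<in>\<D>. norm (f (Sup J) - f (Inf J))) + (\<Sum>J\<in>\<D>. norm (g (Sup J) - g (Inf J))))"
      by (simp add: sum.distrib flip: sum_distrib_left)
    also have "\<dots> < B * (\<epsilon> / (2 * B) + \<epsilon> / (2 * B))"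
      using \<delta>(2)[of \<D>] \<gamma>(2)[of \<D>] * B by (intro mult_strict_left_mono add_strict_mono) auto
    also have "\<dots> = \<epsilon>" using B by (simp add: field_simps)
    finally show "(\<Sum>J\<in>\<D>. norm (h (Sup J) - h (Inf J))) < \<epsilon>" .
  qed (use \<delta>(1) \<gamma>(1) in auto)
qed

lemma abs_cont_on_cnj:
  assumes "abs_cont_on c d f"
  shows "abs_cont_on c d (\<lambda>x. cnj (f x))"
proof (rule abs_cont_on_dominated[OF assms assms, of 1])
  fix x y
  have "norm (cnj (f x) - cnj (f y)) = norm (f x - f y)"
    by (metis complex_cnj_diff complex_mod_cnj)
  then show "norm (cnj (f x) - cnj (f y)) \<le> 1 * (norm (f x - f y) + norm (f x - f y))" by simp
qed simp

lemma abs_cont_on_lincomb: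
  assumes "abs_cont_on c d f" "abs_cont_on c d g"
  shows "abs_cont_on c d (\<lambda>x. \<alpha> * f x + \<beta> * g x)"
\<comment> \<open>The summand 1 keeps the constant positive when both coefficients vanish.\<close>
proof (rule abs_cont_on_dominated[OF assms, of "1 + norm \<alpha> + norm \<beta>"])
  fix x y
  have "norm (\<alpha> * f x + \<beta> * g x - (\<alpha> * f y + \<beta> * g y)) = norm (\<alpha> * (f x - f y) + \<beta> * (g x - g y))"
    by (simp add: algebra_simps)
  also have "\<dots> \<le> norm \<alpha> * norm (f x - f y) + norm \<beta> * norm (g x - g y)"
    by (metis norm_mult norm_triangle_ineq)
  also have "\<dots> \<le> (1 + norm \<alpha> + norm \<beta>) * norm (f x - f y) + (1 + norm \<alpha> + norm \<beta>) * norm (g x - g y)"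
    by (intro add_mono mult_right_mono) auto
  finally show "norm (\<alpha> * f x + \<beta> * g x - (\<alpha> * f y + \<beta> * g y))
      \<le> (1 + norm \<alpha> + norm \<beta>) * (norm (f x - f y) + norm (g x - g y))"
    by (simp add: algebra_simps)
qed (simp add: add_pos_nonneg)

text \<open>The increment of the product is \<open>(f x - f y) * g x + f y * (g x - g y)\<close>,
  and both factors are bounded because they are continuous on a compact interval.\<close>

lemma abs_cont_on_mult:
  assumes "abs_cont_on c d f" "abs_cont_on c d g"
  shows "abs_cont_on c d (\<lambda>x. f x * g x)"
proof -
  have bdd: "\<exists>B>0. \<forall>x\<in>{c..d}. norm (h x) \<le> B" if "abs_cont_on c d h" for h
    using compact_imp_bounded[OF compact_continuous_image[OF abs_cont_on_imp_continuous_on[OF that]]]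
    by (simp add: bounded_pos)
  obtain A where A: "A > 0" "\<forall>x\<in>{c..d}. norm (f x) \<le> A" using bdd assms by blast
  obtain B where B: "B > 0" "\<forall>x\<in>{c..d}. norm (g x) \<le> B" using bdd assms by blast
  show ?thesis
  proof (rule abs_cont_on_dominated[OF assms, of "A + B"])
    fix x y assume xy: "x \<in> {c..d}" "y \<in> {c..d}"
    have "norm (f x * g x - f y * g y) = norm ((f x - f y) * g x + f y * (g x - g y))"
      by (simp add: algebra_simps)
    also have "\<dots> \<le> norm (f x - f y) * norm (g x) + norm (f y) * norm (g x - g y)"
      by (metis norm_mult norm_triangle_ineq)
    also have "\<dots> \<le> norm (f x - f y) * (A + B) + (A + B) * norm (g x - g y)"
      using A(1,2) B(1,2) xy by (intro add_mono mult_left_mono mult_right_mono) (auto intro: add_increasing add_increasing2)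
    finally show "norm (f x * g x - f y * g y) \<le> (A + B) * (norm (f x - f y) + norm (g x - g y))"
      by (simp add: algebra_simps)
  qed (use A B in auto)
qed

text \<open>The exceptional null set is covered by an open set so small that absolute continuity
  makes its contribution to every fine Riemann sum negligible; elsewhere the usual straddle
  estimate applies.\<close>

lemma abs_cont_on_has_integral:
  fixes F f :: "real \<Rightarrow> complex"
  assumes AC: "abs_cont_on c d F" and "c \<le> d" and N: "negligible N"
    and deriv: "\<And>x. x \<in> {c..d} - N \<Longrightarrow> (F has_vector_derivative f x) (at x within {c..d})"
  shows "(f has_integral (F d - F c)) {c..d}"
proof -
  \<comment> \<open>With value 0 on \<open>N\<close>, a tag in \<open>N\<close> contributes only an
    increment of \<open>F\<close> to the error. Passing from \<open>f0\<close> back to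
    \<open>f\<close> changes the integrand on a null set only.\<close>
  define f0 where "f0 x = (if x \<in> N then 0 else f x)" for x
  have "(f0 has_integral (F d - F c)) (cbox c d)"
    unfolding has_integral
  proof (intro allI impI)
    fix \<epsilon> :: real assume "\<epsilon> > 0"
    \<comment> \<open>The denominator uses \<open>d - c + 1\<close> so that it is nonzero also for
      \<open>c = d\<close>.\<close>
    define e where "e = \<epsilon> / (2 * (d - c + 1))"
    have "e > 0" using \<open>\<epsilon> > 0\<close> \<open>c \<le> d\<close> by (simp add: e_def)
    have "e * (d - c) < \<epsilon> / 2"
      using \<open>\<epsilon> > 0\<close> \<open>c \<le> d\<close> by (simp add: e_def field_simps)
    obtain \<delta> where \<delta>: "\<delta> > 0"
      "\<And>\<D>. \<lbrakk>\<D> division_of \<Union>\<D>; \<Union>\<D> \<subseteq> {c..d}; (\<Sum>J\<in>\<D>. Sup J - Inf J) < \<delta>\<rbrakk>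
         \<Longrightarrow> (\<Sum>J\<in>\<D>. norm (F (Sup J) - F (Inf J))) < \<epsilon> / 2"
      by (rule abs_cont_onD[OF AC half_gt_zero[OF \<open>\<epsilon> > 0\<close>]]) (erule that, blast)
    obtain U where U: "open U" "N \<subseteq> U" "U \<in> lmeasurable" "measure lebesgue U < \<delta>"
    proof -
      have Nm: "N \<in> lmeasurable" "measure lebesgue N = 0"
        using N by (rule negligible_imp_measurable, rule negligible_imp_measure0)
      obtain U where "open U" "N \<subseteq> U" "U - N \<in> lmeasurable" "emeasure lebesgue (U - N) < ennreal \<delta>"
        using sets_lebesgue_outer_open[of N \<delta>] Nm \<delta>(1) by blast
      moreover have "emeasure lebesgue U = emeasure lebesgue (U - N)"
        using N \<open>open U\<close> emeasure_Diff_null_set[of N lebesgue U] by (simp add: negligible_iff_null_sets)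
      moreover have "U \<in> lmeasurable"
        using \<open>open U\<close> \<open>emeasure lebesgue U = emeasure lebesgue (U - N)\<close> \<open>U - N \<in> lmeasurable\<close>
        by (auto simp: fmeasurable_def)
      ultimately show ?thesis
        using that[of U] \<delta>(1) by (auto simp: emeasure_eq_measure2 ennreal_less_iff)
    qed
    \<comment> \<open>Radii of the gauge: at a point of \<open>N\<close> the ball must stay inside
      \<open>U\<close>; at any other point of the interval the linear approximation of
      \<open>F\<close> must hold with relative error \<open>e\<close>; outside the interval the
      radius is arbitrary.\<close>
    have "\<exists>r>0. (x \<in> N \<longrightarrow> ball x r \<subseteq> U) \<and> (x \<in> {c..d} - N \<longrightarrow>
        (\<forall>y\<in>{c..d}. norm (y - x) < r \<longrightarrow> norm (F y - F x - (y - x) *\<^sub>R f x) \<le> e * norm (y - x)))" for x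
    proof (cases "x \<in> N")
      case True
      then show ?thesis using U(1,2) openE by (metis DiffE subsetD)
    next
      case False
      show ?thesis
      proof (cases "x \<in> {c..d}")
        case True
        then show ?thesis
          using deriv[of x] False \<open>e > 0\<close>
          unfolding has_vector_derivative_def has_derivative_within_alt by blast
      next
        case False
        with \<open>x \<notin> N\<close> show ?thesis by (intro exI[of _ 1]) auto
      qed
    qed
    then obtain r where r: "\<And>x. r x > 0" "\<And>x. x \<in> N \<Longrightarrow> ball x (r x) \<subseteq> U"
      "\<And>x y. \<lbrakk>x \<in> {c..d} - N; y \<in> {c..d}; norm (y - x) < r x\<rbrakk>
          \<Longrightarrow> norm (F y - F x - (y - x) *\<^sub>R f x) \<le> e * norm (y - x)"
      by metis
    show "\<exists>\<gamma>. gauge \<gamma> \<and> (\<forall>p. p tagged_division_of cbox c d \<and> \<gamma> fine p \<longrightarrow>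
        norm ((\<Sum>(x, K)\<in>p. measure lborel K *\<^sub>R f0 x) - (F d - F c)) < \<epsilon>)"
    proof (intro exI[of _ "\<lambda>x. ball x (r x)"] conjI allI impI)
      show "gauge (\<lambda>x. ball x (r x))" using r(1) gauge_ball_dependent by blast
      fix p assume "p tagged_division_of cbox c d \<and> (\<lambda>x. ball x (r x)) fine p"
      then have p: "p tagged_division_of {c..d}" and fine: "(\<lambda>x. ball x (r x)) fine p" by auto
      have "finite p" using p by blast
      have K: "\<exists>u v. K = {u..v} \<and> u \<le> v \<and> x \<in> {u..v} \<and> {u..v} \<subseteq> {c..d} \<and> {u..v} \<subseteq> ball x (r x)"
        if xK: "(x, K) \<in> p" for x K
      proof -
        obtain u v where "K = cbox u v" using tagged_division_ofD(4)[OF p xK] by blast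
        moreover have "x \<in> K" "K \<subseteq> {c..d}" using tagged_division_ofD(2,3)[OF p xK] by auto
        moreover have "K \<subseteq> ball x (r x)" using fine xK by (auto simp: fine_def)
        ultimately show ?thesis by (intro exI[of _ u] exI[of _ v]) auto
      qed
      define pN where "pN = {(x, K) \<in> p. x \<in> N}"
      define g where "g = (\<lambda>(x, K). measure lborel K *\<^sub>R f0 x - (F (Sup K) - F (Inf K)))"
      have "pN \<subseteq> p" by (auto simp: pN_def)
      \<comment> \<open>The intervals tagged in \<open>N\<close> do not overlap and lie in
        \<open>U\<close>, so their total length is below \<delta> and absolute continuity controls
        the increments of \<open>F\<close>.\<close>
      have "norm (sum g pN) < \<epsilon> / 2"
      proof -
        have part: "pN tagged_partial_division_of {c..d}"
          using p tagged_partial_division_subset[OF _ \<open>pN \<subseteq> p\<close>] by (simp add: tagged_division_of_def)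
        note self = tagged_partial_division_of_Union_self[OF part]
        note div = division_of_tagged_division[OF self]
        have sub: "\<Union>(snd ` pN) \<subseteq> {c..d} \<inter> U"
          using K r(2) by (fastforce simp: pN_def)
        have "(\<Sum>J\<in>snd ` pN. Sup J - Inf J) = (\<Sum>J\<in>snd ` pN. measure lebesgue J)"
        proof (rule sum.cong[OF refl])
          fix J assume "J \<in> snd ` pN"
          then obtain x where "(x, J) \<in> p" by (auto simp: pN_def)
          then obtain u v where "J = {u..v}" "u \<le> v" using K by blast
          then show "Sup J - Inf J = measure lebesgue J" by (simp add: measure_completion)
        qed
        also have "\<dots> = measure lebesgue (\<Union>(snd ` pN))"
          using content_division[OF div] by simp
        also have "\<dots> \<le> measure lebesgue U"
          using sub U(3) lmeasurable_division[OF div] by (intro measure_mono_fmeasurable) auto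
        finally have "(\<Sum>J\<in>snd ` pN. Sup J - Inf J) < \<delta>" using U(4) by simp
        then have "(\<Sum>J\<in>snd ` pN. norm (F (Sup J) - F (Inf J))) < \<epsilon> / 2"
          using \<delta>(2)[of "snd ` pN"] div sub by auto
        moreover have "(\<Sum>(x, J)\<in>pN. norm (F (Sup J) - F (Inf J))) = (\<Sum>J\<in>snd ` pN. norm (F (Sup J) - F (Inf J)))"
        proof -
          \<comment> \<open>the infimum and supremum of the empty interval are junk values\<close>
          define D where "D J = (if J = {} then 0 else norm (F (Sup J) - F (Inf J)))" for J
          have D: "D J = norm (F (Sup J) - F (Inf J))" if J: "(x, J) \<in> pN" for x J
            using K[of x J] J by (auto simp: D_def pN_def)
          have "(\<Sum>(x, J)\<in>pN. norm (F (Sup J) - F (Inf J))) = (\<Sum>(x, J)\<in>pN. D J)"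
            by (rule sum.cong) (auto simp: D)
          \<comment> \<open>Different tags can share an interval only if its interior is empty.
            \<open>D\<close> vanishes on such an interval, so summing over pairs and over intervals
            gives the same value.\<close>
          also have "\<dots> = (\<Sum>J\<in>snd ` pN. D J)"
            by (rule sum.over_tagged_division_lemma[OF self]) (auto simp: D_def)
          also have "\<dots> = (\<Sum>J\<in>snd ` pN. norm (F (Sup J) - F (Inf J)))"
            by (rule sum.cong) (auto simp: D)
          finally show ?thesis .
        qed
        moreover have "norm (sum g pN) \<le> (\<Sum>(x, J)\<in>pN. norm (F (Sup J) - F (Inf J)))"
          by (rule sum_norm_le) (auto simp: pN_def g_def f0_def norm_minus_commute)
        ultimately show ?thesis by linarith
      qed
      moreover have "norm (sum g (p - pN)) < \<epsilon> / 2"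
      proof -
        have "norm (sum g (p - pN)) \<le> (\<Sum>(x, K)\<in>p - pN. e * (Sup K - Inf K))"
        proof (rule sum_norm_le, clarify)
          fix x K assume xK: "(x, K) \<in> p" "(x, K) \<notin> pN"
          then obtain u v where uv: "K = {u..v}" "u \<le> v" "x \<in> {u..v}" "{u..v} \<subseteq> {c..d}" "{u..v} \<subseteq> ball x (r x)"
            using K by blast
          have x: "x \<in> {c..d} - N" using xK uv by (auto simp: pN_def)
          have "u \<in> {u..v}" "v \<in> {u..v}" using uv(2) by auto
          then have "norm (u - x) < r x" "norm (v - x) < r x" "u \<in> {c..d}" "v \<in> {c..d}"
            using uv(4,5) by (auto simp: subset_iff dist_norm norm_minus_commute)
          then have *: "norm (F u - F x - (u - x) *\<^sub>R f x) \<le> e * norm (u - x)"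
              "norm (F v - F x - (v - x) *\<^sub>R f x) \<le> e * norm (v - x)"
            using r(3)[OF x] by auto
          \<comment> \<open>The tag lies between \<open>u\<close> and \<open>v\<close>, so the two
            one-sided errors add up to a multiple of exactly \<open>v - u\<close>.\<close>
          have "g (x, K) = (F u - F x - (u - x) *\<^sub>R f x) - (F v - F x - (v - x) *\<^sub>R f x)"
            using uv x by (simp add: g_def f0_def algebra_simps)
          then have "norm (g (x, K)) \<le> e * norm (u - x) + e * norm (v - x)"
            using * norm_triangle_ineq4 by (smt (verit))
          also have "\<dots> = e * (Sup K - Inf K)"
            using uv by (simp add: algebra_simps)
          finally show "norm (g (x, K)) \<le> e * (Sup K - Inf K)" .
        qed
        also have "\<dots> \<le> (\<Sum>(x, K)\<in>p. e * (Sup K - Inf K))"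
        proof (rule sum_mono2[OF \<open>finite p\<close>])
          fix y assume "y \<in> p - (p - pN)"
          then show "0 \<le> (case y of (x, K) \<Rightarrow> e * (Sup K - Inf K))"
            using K \<open>e > 0\<close> by (fastforce simp: pN_def)
        qed auto
        also have "\<dots> = e * (d - c)"
          using additive_tagged_division_1[OF \<open>c \<le> d\<close> p, of "\<lambda>x. x"]
          by (simp add: split_def flip: sum_distrib_left)
        finally show ?thesis using \<open>e * (d - c) < \<epsilon> / 2\<close> by linarith
      qed
      moreover have "(\<Sum>(x, K)\<in>p. measure lborel K *\<^sub>R f0 x) - (F d - F c) = sum g p"
        using additive_tagged_division_1[OF \<open>c \<le> d\<close> p, of F]
        by (simp add: g_def split_def sum_subtractf)
      moreover have "sum g p = sum g (p - pN) + sum g pN"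
        using sum.subset_diff[OF \<open>pN \<subseteq> p\<close> \<open>finite p\<close>] .
      ultimately show "norm ((\<Sum>(x, K)\<in>p. measure lborel K *\<^sub>R f0 x) - (F d - F c)) < \<epsilon>"
        using norm_triangle_ineq[of "sum g (p - pN)" "sum g pN"] by simp
    qed
  qed
  then have "(f0 has_integral (F d - F c)) {c..d}" by simp
  then show ?thesis
    by (rule has_integral_spike[OF N, rotated]) (simp add: f0_def)
qed

section \<open>Eigenspaces\<close>

text \<open>Puts a point, for possibly infinite endpoints, into the interior of a compact
  subinterval, which is where local absolute continuity gives information.\<close>

lemma einterval_cball:
  assumes "x \<in> einterval a b"
  obtains c d where "a < ereal c" "c < x" "x < d" "ereal d < b" "{c..d} \<subseteq> einterval a b"
proof -
  obtain e where e: "e > 0" "cball x e \<subseteq> einterval a b"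
    using open_einterval assms open_contains_cball by blast
  then have "x - e \<in> einterval a b" "x + e \<in> einterval a b" "{x - e..x + e} \<subseteq> einterval a b"
    by (auto simp: subset_iff dist_real_def cball_eq_atLeastAtMost)
  with e(1) show ?thesis by (intro that[of "x - e" "x + e"]) (auto simp: einterval_iff)
qed

lemma AC_loc_imp_continuous_on:
  assumes "AC_loc a b f"
  shows "continuous_on (einterval a b) f"
proof (rule continuous_at_imp_continuous_on, rule ballI)
  fix x assume "x \<in> einterval a b"
  then obtain c d where cd: "a < ereal c" "c < x" "x < d" "ereal d < b"
    by (rule einterval_cball)
  then have "continuous_on {c..d} f"
    using assms abs_cont_on_imp_continuous_on unfolding AC_loc_def by auto
  then show "isCont f x"
    using cd by (intro continuous_on_interior[of "{c..d}"]) auto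
qed

text \<open>The set where two continuous functions differ is open, and a nonempty open set is not
  negligible.\<close>

lemma ae_on_continuous_eq:
  assumes "open S" "continuous_on S f" "continuous_on S g" "ae_on S (\<lambda>x. f x = g x)" "x \<in> S"
  shows "f x = (g x :: complex)"
proof (rule ccontr)
  assume ne: "f x \<noteq> g x"
  define U where "U = S \<inter> (\<lambda>x. f x - g x) -` (- {0})"
  have "open U"
    unfolding U_def using assms(1-3) by (intro continuous_open_preimage continuous_on_diff) auto
  obtain N where N: "N \<in> null_sets lebesgue" "{y \<in> space lebesgue. \<not> (y \<in> S \<longrightarrow> f y = g y)} \<subseteq> N"
    using assms(4) unfolding ae_on_def eventually_ae_filter by blast
  have "U \<subseteq> N" using N(2) by (auto simp: U_def)
  then have "negligible U" using N(1) negligible_iff_null_sets negligible_subset by blast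
  moreover have "x \<in> U" using ne assms(5) by (simp add: U_def)
  ultimately show False using open_not_negligible \<open>open U\<close> by blast
qed

lemma ae_on_mono:
  assumes "ae_on A P" "\<And>x. \<lbrakk>x \<in> A; P x\<rbrakk> \<Longrightarrow> Q x"
  shows "ae_on A Q"
  using assms(1) unfolding ae_on_def by eventually_elim (use assms(2) in blast)

lemma ae_on_conj:
  assumes "ae_on A P" "ae_on A Q"
  shows "ae_on A (\<lambda>x. P x \<and> Q x)"
  using assms unfolding ae_on_def by eventually_elim blast

section \<open>Uniqueness and linearity of the continuous representative of
  \<open>p f'\<close>\<close>

lemma is_pderiv_ae_on:
  assumes "is_pderiv S f F"
  shows "ae_on (dom_interval S) (\<lambda>x. f differentiable at x \<and> F differentiable at x \<and>
    F x = complex_of_real (coeff_p S x) * vector_derivative f (at x))"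
proof -
  have "ae_on (dom_interval S) (\<lambda>x. f differentiable at x \<and> F differentiable at x)"
    "ae_on (dom_interval S) (\<lambda>x. F x = complex_of_real (coeff_p S x) * vector_derivative f (at x))"
    using assms by (auto simp: is_pderiv_def)
  from ae_on_conj[OF this] show ?thesis by (rule ae_on_mono) auto
qed

text \<open>Both representatives equal \<open>p f'\<close> almost everywhere and are continuous,
  hence agree on the interval. The choice made by \<open>SOME\<close> in \<open>pderiv_fun\<close>
  therefore has no influence there.\<close>

lemma pderiv_fun_eq:
  assumes "is_pderiv S f g" "x \<in> dom_interval S"
  shows "pderiv_fun S f x = g x"
proof (rule ae_on_continuous_eq[OF open_einterval _ _ _ assms(2)])
  have F: "is_pderiv S f (pderiv_fun S f)"
    unfolding pderiv_fun_def using assms(1) by (rule someI[of "is_pderiv S f"])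
  show "continuous_on (dom_interval S) (pderiv_fun S f)" "continuous_on (dom_interval S) g"
    using F assms(1) AC_loc_imp_continuous_on unfolding is_pderiv_def by blast+
  show "ae_on (dom_interval S) (\<lambda>x. pderiv_fun S f x = g x)"
    by (rule ae_on_mono[OF ae_on_conj[OF is_pderiv_ae_on[OF F] is_pderiv_ae_on[OF assms(1)]]]) auto
qed

lemma is_pderiv_pderiv_fun:
  assumes "regular_fun S f"
  shows "is_pderiv S f (pderiv_fun S f)"
  using assms unfolding regular_fun_def pderiv_fun_def by (rule someI_ex)

lemma AC_loc_lincomb:
  assumes "AC_loc a b f" "AC_loc a b g"
  shows "AC_loc a b (\<lambda>x. \<alpha> * f x + \<beta> * g x)"
  using assms abs_cont_on_lincomb unfolding AC_loc_def by blast

lemma has_vector_derivative_lincomb: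
  fixes f g :: "real \<Rightarrow> complex"
  assumes "f differentiable at x" "g differentiable at x"
  shows "((\<lambda>x. \<alpha> * f x + \<beta> * g x) has_vector_derivative
    (\<alpha> * vector_derivative f (at x) + \<beta> * vector_derivative g (at x))) (at x)"
  using assms unfolding vector_derivative_works
  by (intro has_vector_derivative_add has_vector_derivative_mult_right)

lemma is_pderiv_lincomb:
  assumes f: "is_pderiv S f F" and g: "is_pderiv S g G"
  shows "is_pderiv S (\<lambda>x. \<alpha> * f x + \<beta> * g x) (\<lambda>x. \<alpha> * F x + \<beta> * G x)"
proof -
  note ae = ae_on_conj[OF is_pderiv_ae_on[OF f] is_pderiv_ae_on[OF g]]
  have "ae_on (dom_interval S) (\<lambda>x. (\<lambda>x. \<alpha> * f x + \<beta> * g x) differentiable at x \<and>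
      (\<lambda>x. \<alpha> * F x + \<beta> * G x) differentiable at x)"
    by (rule ae_on_mono[OF ae]) auto
  moreover have "ae_on (dom_interval S) (\<lambda>x. \<alpha> * F x + \<beta> * G x =
      complex_of_real (coeff_p S x) * vector_derivative (\<lambda>x. \<alpha> * f x + \<beta> * g x) (at x))"
    by (rule ae_on_mono[OF ae])
      (auto simp: vector_derivative_at[OF has_vector_derivative_lincomb] algebra_simps)
  ultimately show ?thesis
    using assms AC_loc_lincomb unfolding is_pderiv_def by blast
qed

lemma regular_fun_lincomb:
  assumes "regular_fun S f" "regular_fun S g"
  shows "regular_fun S (\<lambda>x. \<alpha> * f x + \<beta> * g x)"
  using assms is_pderiv_lincomb unfolding regular_fun_def by blast

lemma pderiv_fun_lincomb:
  assumes "regular_fun S f" "regular_fun S g" "x \<in> dom_interval S"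
  shows "pderiv_fun S (\<lambda>x. \<alpha> * f x + \<beta> * g x) x = \<alpha> * pderiv_fun S f x + \<beta> * pderiv_fun S g x"
  by (rule pderiv_fun_eq[OF is_pderiv_lincomb assms(3)]) (use assms is_pderiv_pderiv_fun in auto)

text \<open>Linearity holds only almost everywhere: where a quasi-derivative fails to be
  differentiable, \<open>vector_derivative\<close> has an unspecified value.\<close>

lemma sl_expr_lincomb:
  assumes f: "regular_fun S f" and g: "regular_fun S g"
  shows "ae_on (dom_interval S)
    (\<lambda>x. sl_expr S (\<lambda>x. \<alpha> * f x + \<beta> * g x) x = \<alpha> * sl_expr S f x + \<beta> * sl_expr S g x)"
proof -
  have "sl_expr S (\<lambda>x. \<alpha> * f x + \<beta> * g x) x = \<alpha> * sl_expr S f x + \<beta> * sl_expr S g x"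
    if x: "x \<in> dom_interval S" and "pderiv_fun S f differentiable at x" "pderiv_fun S g differentiable at x" for x
  proof -
    have "(pderiv_fun S (\<lambda>x. \<alpha> * f x + \<beta> * g x) has_vector_derivative
        (\<alpha> * vector_derivative (pderiv_fun S f) (at x) + \<beta> * vector_derivative (pderiv_fun S g) (at x))) (at x)"
      \<comment> \<open>Linearity of \<open>pderiv_fun\<close> is known on the open interval only,
        which suffices for a derivative at an interior point.\<close>
      by (rule has_vector_derivative_transform_within_open[OF has_vector_derivative_lincomb open_einterval x])
        (use that pderiv_fun_lincomb[OF f g] in auto)
    then show ?thesis
      by (simp add: sl_expr_def vector_derivative_at algebra_simps)
  qed
  then show ?thesis
    by (intro ae_on_mono[OF ae_on_conj[OF is_pderiv_ae_on is_pderiv_ae_on, OF is_pderiv_pderiv_fun is_pderiv_pderiv_fun, OF f g]]) blast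
qed

section \<open>Weighted square integrability\<close>

text \<open>Local integrability gives measurability on compact subintervals; exhausting the interval
  by these, the weight is a pointwise limit of measurable cut-offs.\<close>

lemma coeff_w_measurable:
  assumes "sl_coefficients S"
  shows "set_borel_measurable lebesgue (dom_interval S) (coeff_w S)"
proof -
  have "left_end S < right_end S" using assms by (simp add: sl_coefficients_def)
  then obtain u l :: "nat \<Rightarrow> real" where ul: "dom_interval S = (\<Union>i. {l i..u i})"
    "incseq u" "decseq l" "\<And>i. l i < u i" "\<And>i. left_end S < l i" "\<And>i. u i < right_end S"
    "(\<lambda>i. ereal (l i)) \<longlonglongrightarrow> left_end S" "(\<lambda>i. ereal (u i)) \<longlonglongrightarrow> right_end S"
    by (rule einterval_Icc_approximation) (rule that; assumption)
  show ?thesis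
    unfolding set_borel_measurable_def
  proof (rule borel_measurable_LIMSEQ_real)
    fix i
    have "coeff_w S absolutely_integrable_on {l i..u i}"
      using assms ul(4-6)[of i] less_imp_le[of "l i" "u i"] by (simp add: sl_coefficients_def L1_loc_def)
    then show "(\<lambda>x. indicator {l i..u i} x *\<^sub>R coeff_w S x) \<in> borel_measurable lebesgue"
      unfolding set_integrable_def by (rule borel_measurable_integrable)
  next
    fix x
    have "incseq (\<lambda>i. {l i..u i})"
      using ul(2,3) unfolding incseq_def decseq_def by (force intro: order_trans)
    then show "(\<lambda>i. indicator {l i..u i} x *\<^sub>R coeff_w S x) \<longlonglongrightarrow> indicator (dom_interval S) x *\<^sub>R coeff_w S x"
      unfolding ul(1) by (intro tendsto_scaleR tendsto_const LIMSEQ_indicator_incseq)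
  qed
qed

text \<open>The product of two moduli is at most the sum of their squares, and the weight is
  positive almost everywhere. This is the integrability of the integrand in the Lagrange
  identity.\<close>

lemma sq_integrable_on_mult_cnj:
  assumes S: "sl_coefficients S" and A: "A \<in> sets lebesgue" "A \<subseteq> dom_interval S"
    and f: "sq_integrable_on S A f" and g: "sq_integrable_on S A g"
  shows "set_integrable lebesgue A (\<lambda>x. coeff_w S x * (f x * cnj (g x)))"
proof (rule set_integrable_bound)
  show "set_integrable lebesgue A (\<lambda>x. (cmod (f x))\<^sup>2 * coeff_w S x + (cmod (g x))\<^sup>2 * coeff_w S x)"
    using f g unfolding sq_integrable_on_def by (intro set_integral_add) auto
  have cnj: "(\<lambda>x. cnj (h x)) \<in> borel_measurable lebesgue" if "h \<in> borel_measurable lebesgue" for h :: "real \<Rightarrow> complex"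
    by (rule measurable_compose[OF that borel_measurable_continuous_onI]) (intro continuous_intros)
  have w: "set_borel_measurable lebesgue A (coeff_w S)"
    using set_borel_measurable_subset[OF coeff_w_measurable[OF S] A] .
  \<comment> \<open>Measurability is available only for the functions cut off to \<open>A\<close>,
    so each factor carries its own indicator; the product of the three is again the
    indicator.\<close>
  have "(\<lambda>x. complex_of_real (indicator A x *\<^sub>R coeff_w S x) * ((indicator A x *\<^sub>R f x) * cnj (indicator A x *\<^sub>R g x)))
      \<in> borel_measurable lebesgue"
  proof (intro borel_measurable_times cnj)
    show "(\<lambda>x. complex_of_real (indicator A x *\<^sub>R coeff_w S x)) \<in> borel_measurable lebesgue"
      by (rule measurable_compose[OF w[unfolded set_borel_measurable_def] borel_measurable_of_real])
  qed (use f g in \<open>auto simp: sq_integrable_on_def set_borel_measurable_def\<close>)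
  also have "(\<lambda>x. complex_of_real (indicator A x *\<^sub>R coeff_w S x) * ((indicator A x *\<^sub>R f x) * cnj (indicator A x *\<^sub>R g x)))
      = (\<lambda>x. indicator A x *\<^sub>R (coeff_w S x * (f x * cnj (g x))))"
    by (auto simp: indicator_def)
  finally show "set_borel_measurable lebesgue A (\<lambda>x. coeff_w S x * (f x * cnj (g x)))"
    unfolding set_borel_measurable_def .
  have bound: "norm (coeff_w S x * (f x * cnj (g x))) \<le> norm ((cmod (f x))\<^sup>2 * coeff_w S x + (cmod (g x))\<^sup>2 * coeff_w S x)"
    if "coeff_w S x > 0" for x
  proof -
    have "cmod (f x) * cmod (g x) \<le> (cmod (f x))\<^sup>2 + (cmod (g x))\<^sup>2"
      using sum_squares_bound[of "cmod (f x)" "cmod (g x)"] mult_nonneg_nonneg[OF norm_ge_zero[of "f x"] norm_ge_zero[of "g x"]] by linarith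
    then have "coeff_w S x * (cmod (f x) * cmod (g x)) \<le> coeff_w S x * ((cmod (f x))\<^sup>2 + (cmod (g x))\<^sup>2)"
      using that by simp
    then show ?thesis using that by (simp add: norm_mult algebra_simps)
  qed
  have "AE x in lebesgue. x \<in> dom_interval S \<longrightarrow> coeff_w S x > 0"
    using S by (simp add: sl_coefficients_def ae_on_def)
  then show "AE x in lebesgue. x \<in> A \<longrightarrow> norm (coeff_w S x * (f x * cnj (g x)))
      \<le> norm ((cmod (f x))\<^sup>2 * coeff_w S x + (cmod (g x))\<^sup>2 * coeff_w S x)"
    by eventually_elim (use A(2) bound in blast)
qed

text \<open>Expanding the squared modulus leaves two squares and the real part of a cross term,
  which is integrable by \<open>sq_integrable_on_mult_cnj\<close>.\<close>

lemma sq_integrable_on_lincomb: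
  assumes S: "sl_coefficients S" and A: "A \<in> sets lebesgue" "A \<subseteq> dom_interval S"
    and f: "sq_integrable_on S A f" and g: "sq_integrable_on S A g"
  shows "sq_integrable_on S A (\<lambda>x. \<alpha> * f x + \<beta> * g x)"
proof -
  have "(\<lambda>x. \<alpha> * (indicator A x *\<^sub>R f x) + \<beta> * (indicator A x *\<^sub>R g x)) \<in> borel_measurable lebesgue"
    using f g unfolding sq_integrable_on_def set_borel_measurable_def
    by (intro borel_measurable_times borel_measurable_add) auto
  also have "(\<lambda>x. \<alpha> * (indicator A x *\<^sub>R f x) + \<beta> * (indicator A x *\<^sub>R g x)) =
      (\<lambda>x. indicator A x *\<^sub>R (\<alpha> * f x + \<beta> * g x))"
    by (auto simp: indicator_def)
  finally have "set_borel_measurable lebesgue A (\<lambda>x. \<alpha> * f x + \<beta> * g x)"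
    unfolding set_borel_measurable_def .
  moreover have "set_integrable lebesgue A (\<lambda>x. (cmod (\<alpha> * f x + \<beta> * g x))\<^sup>2 * coeff_w S x)"
  proof -
    have "set_integrable lebesgue A (\<lambda>x. (cmod \<alpha>)\<^sup>2 * ((cmod (f x))\<^sup>2 * coeff_w S x)
        + (cmod \<beta>)\<^sup>2 * ((cmod (g x))\<^sup>2 * coeff_w S x)
        + 2 * Re (\<alpha> * cnj \<beta> * (coeff_w S x * (f x * cnj (g x)))))"
    proof -
      have "set_integrable lebesgue A (\<lambda>x. \<alpha> * cnj \<beta> * (coeff_w S x * (f x * cnj (g x))))"
        using sq_integrable_on_mult_cnj[OF assms] by (rule set_integrable_mult_right)
      then have "set_integrable lebesgue A (\<lambda>x. Re (\<alpha> * cnj \<beta> * (coeff_w S x * (f x * cnj (g x)))))"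
        unfolding set_integrable_def using integrable_Re by fastforce
      then show ?thesis
        using f g unfolding sq_integrable_on_def by (intro set_integral_add set_integrable_mult_right) auto
    qed
    also have "(\<lambda>x. (cmod \<alpha>)\<^sup>2 * ((cmod (f x))\<^sup>2 * coeff_w S x)
        + (cmod \<beta>)\<^sup>2 * ((cmod (g x))\<^sup>2 * coeff_w S x)
        + 2 * Re (\<alpha> * cnj \<beta> * (coeff_w S x * (f x * cnj (g x)))))
      = (\<lambda>x. (cmod (\<alpha> * f x + \<beta> * g x))\<^sup>2 * coeff_w S x)"
      by (rule ext, simp add: cmod_power2) (simp add: algebra_simps power2_eq_square)
    finally show ?thesis .
  qed
  ultimately show ?thesis unfolding sq_integrable_on_def by blast
qed

text \<open>Completeness of Lebesgue measure carries measurability over to a function that agrees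
  almost everywhere.\<close>

lemma sq_integrable_on_cong_AE:
  assumes A: "A \<in> sets lebesgue" and f: "sq_integrable_on S A f" and eq: "ae_on A (\<lambda>x. f x = g x)"
  shows "sq_integrable_on S A g"
  unfolding sq_integrable_on_def set_borel_measurable_def
proof
  show g: "(\<lambda>x. indicator A x *\<^sub>R g x) \<in> borel_measurable lebesgue"
    by (rule borel_measurable_AE[of "\<lambda>x. indicator A x *\<^sub>R f x"])
      (use f eq in \<open>auto simp: sq_integrable_on_def set_borel_measurable_def ae_on_def indicator_def\<close>)
  let ?F = "\<lambda>x. indicator A x *\<^sub>R ((cmod (f x))\<^sup>2 * coeff_w S x)"
  let ?G = "\<lambda>x. indicator A x *\<^sub>R ((cmod (g x))\<^sup>2 * coeff_w S x)"
  have F: "integrable lebesgue ?F"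
    using f unfolding sq_integrable_on_def set_integrable_def by blast
  have FG: "AE x in lebesgue. ?F x = ?G x"
    using eq unfolding ae_on_def by eventually_elim (auto simp: indicator_def)
  moreover have "?G \<in> borel_measurable lebesgue"
    using borel_measurable_AE[OF borel_measurable_integrable[OF F] FG] .
  ultimately show "set_integrable lebesgue A (\<lambda>x. (cmod (g x))\<^sup>2 * coeff_w S x)"
    using F integrable_cong_AE unfolding set_integrable_def by blast
qed

text \<open>The kernel of the maximal operator minus \<open>z\<close>: no boundary condition is
  imposed, and null functions are included so that it is closed under linear combinations.\<close>

definition eigenspace :: "sl_data \<Rightarrow> complex \<Rightarrow> (real \<Rightarrow> complex) set" where
  "eigenspace S z = {f \<in> D_max S. ae_on (dom_interval S) (\<lambda>x. sl_expr S f x = z * f x)}"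

lemma eigenspace_lincomb:
  assumes S: "sl_coefficients S" and f: "f \<in> eigenspace S z" and g: "g \<in> eigenspace S z"
  shows "(\<lambda>x. \<alpha> * f x + \<beta> * g x) \<in> eigenspace S z"
proof -
  let ?h = "\<lambda>x. \<alpha> * f x + \<beta> * g x"
  have reg: "regular_fun S f" "regular_fun S g"
    and L2: "sq_integrable_on S (dom_interval S) f" "sq_integrable_on S (dom_interval S) g"
    using f g by (auto simp: eigenspace_def D_max_def L2_def)
  have eq: "ae_on (dom_interval S) (\<lambda>x. sl_expr S ?h x = z * ?h x)"
  proof (rule ae_on_mono[OF ae_on_conj[OF sl_expr_lincomb[OF reg, of \<alpha> \<beta>] ae_on_conj]])
    show "ae_on (dom_interval S) (\<lambda>x. sl_expr S f x = z * f x)" "ae_on (dom_interval S) (\<lambda>x. sl_expr S g x = z * g x)"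
      using f g by (auto simp: eigenspace_def)
  qed (auto simp: algebra_simps)
  have h: "sq_integrable_on S (dom_interval S) ?h"
    by (intro sq_integrable_on_lincomb S L2) auto
  \<comment> \<open>Square integrability of \<open>sl_expr S ?h\<close> is read off from the
    eigenvalue equation, which identifies it almost everywhere with \<open>z\<close> times
    \<open>?h\<close>.\<close>
  have "sq_integrable_on S (dom_interval S) (\<lambda>x. z * ?h x)"
    using sq_integrable_on_lincomb[OF S _ _ h h, of z 0] by simp
  then have "sq_integrable_on S (dom_interval S) (sl_expr S ?h)"
    by (rule sq_integrable_on_cong_AE[rotated]) (auto intro: ae_on_mono[OF eq])
  then show ?thesis
    using eq h regular_fun_lincomb[OF reg] by (simp add: eigenspace_def D_max_def L2_def)
qed

section \<open>Boundary brackets\<close>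

text \<open>The eigenvalue equation as a first-order system for \<open>f\<close> and its
  quasi-derivative; positivity of the weight allows the factor \<open>1/w\<close> to be
  cleared.\<close>

lemma sl_expr_eqD:
  assumes S: "sl_coefficients S" and f: "regular_fun S f"
    and eq: "ae_on (dom_interval S) (\<lambda>x. sl_expr S f x = z * f x)"
  shows "ae_on (dom_interval S) (\<lambda>x.
    (f has_vector_derivative vector_derivative f (at x)) (at x) \<and>
    (pderiv_fun S f has_vector_derivative - ((z * coeff_w S x + coeff_q S x) * f x)) (at x) \<and>
    pderiv_fun S f x = complex_of_real (coeff_p S x) * vector_derivative f (at x))"
proof -
  have w: "ae_on (dom_interval S) (\<lambda>x. coeff_w S x > 0)" using S by (simp add: sl_coefficients_def)
  show ?thesis
  proof (rule ae_on_mono[OF ae_on_conj[OF is_pderiv_ae_on[OF is_pderiv_pderiv_fun[OF f]] ae_on_conj[OF w eq]]], elim conjE)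
    fix x
    assume d: "f differentiable at x" "pderiv_fun S f differentiable at x"
      and p: "pderiv_fun S f x = complex_of_real (coeff_p S x) * vector_derivative f (at x)"
      and w: "coeff_w S x > 0" and e: "sl_expr S f x = z * f x"
    have "- vector_derivative (pderiv_fun S f) (at x) = (z * coeff_w S x + coeff_q S x) * f x"
      using e w by (simp add: sl_expr_def field_simps)
    then have "vector_derivative (pderiv_fun S f) (at x) = - ((z * coeff_w S x + coeff_q S x) * f x)"
      by (metis minus_minus)
    then show "(f has_vector_derivative vector_derivative f (at x)) (at x) \<and>
        (pderiv_fun S f has_vector_derivative - ((z * coeff_w S x + coeff_q S x) * f x)) (at x) \<and>
        pderiv_fun S f x = complex_of_real (coeff_p S x) * vector_derivative f (at x)"
      using d p vector_derivative_works by metis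
  qed
qed

text \<open>The bracket is locally absolutely continuous, so it is recovered by integrating its
  almost everywhere derivative, and the two equations turn that derivative into the stated
  integrand.\<close>

lemma lagrange_identity:
  assumes S: "sl_coefficients S" and f: "regular_fun S f" and u: "regular_fun S u"
    and eqf: "ae_on (dom_interval S) (\<lambda>x. sl_expr S f x = z * f x)"
    and equ: "ae_on (dom_interval S) (\<lambda>x. sl_expr S u x = \<zeta> * u x)"
    and xy: "left_end S < ereal x" "x \<le> y" "ereal y < right_end S"
  shows "((\<lambda>s. (z - cnj \<zeta>) * (coeff_w S s * (f s * cnj (u s)))) has_integral
    (bracket S f u y - bracket S f u x)) {x..y}"
proof -
  note ae = ae_on_conj[OF sl_expr_eqD[OF S f eqf] sl_expr_eqD[OF S u equ]]
  have deriv: "ae_on (dom_interval S) (\<lambda>s. (bracket S f u has_vector_derivative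
      ((z - cnj \<zeta>) * (coeff_w S s * (f s * cnj (u s))))) (at s))"
  proof (rule ae_on_mono[OF ae], elim conjE)
    fix s
    let ?F = "pderiv_fun S f" and ?U = "pderiv_fun S u" and ?w = "complex_of_real (coeff_w S s)" and ?q = "complex_of_real (coeff_q S s)"
    let ?f' = "vector_derivative f (at s)" and ?u' = "vector_derivative u (at s)"
    assume d: "(f has_vector_derivative ?f') (at s)" "(u has_vector_derivative ?u') (at s)"
      "(?F has_vector_derivative - ((z * ?w + ?q) * f s)) (at s)"
      "(?U has_vector_derivative - ((\<zeta> * ?w + ?q) * u s)) (at s)"
      and p: "?F s = complex_of_real (coeff_p S s) * ?f'" "?U s = complex_of_real (coeff_p S s) * ?u'"
    have "bracket S f u = (\<lambda>s. f s * cnj (?U s) - ?F s * cnj (u s))"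
      by (simp add: bracket_def fun_eq_iff)
    moreover have "((\<lambda>s. f s * cnj (?U s) - ?F s * cnj (u s)) has_vector_derivative
        (f s * cnj (- ((\<zeta> * ?w + ?q) * u s)) + ?f' * cnj (?U s)
          - (?F s * cnj ?u' + (- ((z * ?w + ?q) * f s)) * cnj (u s)))) (at s)"
      by (intro has_vector_derivative_diff has_vector_derivative_mult has_vector_derivative_cnj d)
    \<comment> \<open>Since \<open>p\<close> and \<open>q\<close> are real, the terms in
      \<open>f' u'\<close> cancel and so do those containing \<open>q\<close>.\<close>
    moreover have "f s * cnj (- ((\<zeta> * ?w + ?q) * u s)) + ?f' * cnj (?U s)
          - (?F s * cnj ?u' + (- ((z * ?w + ?q) * f s)) * cnj (u s))
        = (z - cnj \<zeta>) * (?w * (f s * cnj (u s)))"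
      by (simp add: p algebra_simps)
    ultimately show "(bracket S f u has_vector_derivative
        (z - cnj \<zeta>) * (coeff_w S s * (f s * cnj (u s)))) (at s)" by simp
  qed
  obtain N where N: "N \<in> null_sets lebesgue" "{s \<in> space lebesgue. \<not> (s \<in> dom_interval S \<longrightarrow>
      (bracket S f u has_vector_derivative ((z - cnj \<zeta>) * (coeff_w S s * (f s * cnj (u s))))) (at s))} \<subseteq> N"
    using deriv unfolding ae_on_def eventually_ae_filter by blast
  show ?thesis
  proof (rule abs_cont_on_has_integral)
    show "negligible N" using N(1) negligible_iff_null_sets by blast
    have "abs_cont_on x y h" if "h \<in> {f, u, pderiv_fun S f, pderiv_fun S u}" for h
      using is_pderiv_pderiv_fun[OF f] is_pderiv_pderiv_fun[OF u] xy that
      unfolding is_pderiv_def AC_loc_def by auto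
    then have "abs_cont_on x y (\<lambda>s. 1 * (f s * cnj (pderiv_fun S u s)) + (-1) * (pderiv_fun S f s * cnj (u s)))"
      by (intro abs_cont_on_lincomb abs_cont_on_mult abs_cont_on_cnj) auto
    moreover have "bracket S f u = (\<lambda>s. 1 * (f s * cnj (pderiv_fun S u s)) + (-1) * (pderiv_fun S f s * cnj (u s)))"
      by (simp add: bracket_def fun_eq_iff)
    ultimately show "abs_cont_on x y (bracket S f u)" by simp
    fix s assume s: "s \<in> {x..y} - N"
    have "ereal x \<le> ereal s" "ereal s \<le> ereal y" using s by auto
    then have dom: "s \<in> dom_interval S"
      using xy less_le_trans le_less_trans unfolding einterval_iff by blast
    show "(bracket S f u has_vector_derivative
        ((z - cnj \<zeta>) * (coeff_w S s * (f s * cnj (u s))))) (at s within {x..y})"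
    proof (rule has_vector_derivative_at_within, rule ccontr)
      assume "\<not> (bracket S f u has_vector_derivative
          ((z - cnj \<zeta>) * (coeff_w S s * (f s * cnj (u s))))) (at s)"
      then have "s \<in> N" using dom by (intro subsetD[OF N(2)]) simp
      with s show False by simp
    qed
  qed (rule xy)
qed

section \<open>Existence of the boundary limits\<close>

text \<open>Dominated convergence for moving domains: the indicators are eventually constant at each
  point, and the norm of \<open>h\<close> on \<open>T\<close> is the majorant.\<close>

lemma set_integral_tendsto_sets:
  fixes h :: "'a \<Rightarrow> 'b::{banach, second_countable_topology}"
  assumes h: "set_integrable M T h"
    and A: "\<And>n. A n \<in> sets M" "\<And>n. A n \<subseteq> T" and B: "B \<in> sets M" "B \<subseteq> T"
    and lim: "\<And>s. \<forall>\<^sub>F n in sequentially. s \<in> A n \<longleftrightarrow> s \<in> B"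
  shows "(\<lambda>n. LINT s:A n|M. h s) \<longlonglongrightarrow> (LINT s:B|M. h s)"
  unfolding set_lebesgue_integral_def
proof (rule integral_dominated_convergence)
  show "integrable M (\<lambda>s. norm (indicator T s *\<^sub>R h s))"
    using h unfolding set_integrable_def by (rule integrable_norm)
  show "(\<lambda>s. indicator B s *\<^sub>R h s) \<in> borel_measurable M"
    using set_integrable_subset[OF h B] unfolding set_integrable_def by (rule borel_measurable_integrable)
  show "(\<lambda>s. indicator (A n) s *\<^sub>R h s) \<in> borel_measurable M" for n
    using set_integrable_subset[OF h A] unfolding set_integrable_def by (rule borel_measurable_integrable)
  show "AE s in M. (\<lambda>n. indicator (A n) s *\<^sub>R h s) \<longlonglongrightarrow> indicator B s *\<^sub>R h s"
  proof (rule AE_I2, rule tendsto_eventually)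
    fix s show "\<forall>\<^sub>F n in sequentially. indicator (A n) s *\<^sub>R h s = indicator B s *\<^sub>R h s"
      using lim[of s] by eventually_elim (simp add: indicator_def)
  qed
  show "AE s in M. norm (indicator (A n) s *\<^sub>R h s) \<le> norm (indicator T s *\<^sub>R h s)" for n
    using A(2)[of n] by (intro AE_I2) (auto simp: indicator_def)
qed

text \<open>For \<open>x\<close> near \<open>a\<close>, \<open>G x\<close> is \<open>G d\<close>
  minus the integral of \<open>h\<close> over \<open>[x, d]\<close>, which tends to the integral
  over \<open>(a, d]\<close>. Testing along sequences of extended reals treats a finite and an
  infinite endpoint alike.\<close>

lemma primitive_tendsto_left:
  fixes G h :: "real \<Rightarrow> complex"
  assumes c: "c \<in> einterval a b" and h: "set_integrable lebesgue (einterval a c) h"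
    and G: "\<And>x y. \<lbrakk>a < ereal x; x \<le> y; ereal y < b\<rbrakk> \<Longrightarrow> (h has_integral (G y - G x)) {x..y}"
  shows "\<exists>L. (G \<longlongrightarrow> L) (filtermap real_of_ereal (at_right a))"
proof -
  \<comment> \<open>Being strictly below \<open>c\<close> keeps \<open>(a, d]\<close> inside the
    open interval on which \<open>h\<close> is integrable; being below \<open>b\<close> allows the
    hypothesis on \<open>G\<close> to be used up to \<open>d\<close>.\<close>
  obtain d where d: "a < ereal d" "ereal d < ereal c" "ereal d < b"
  proof -
    have "a < ereal c" "ereal c < b" using c by (auto simp: einterval_iff)
    then obtain d where "a < ereal d" "ereal d < ereal c" using ereal_dense2 by blast
    with \<open>ereal c < b\<close> show ?thesis using that less_trans by blast
  qed
  define B where "B = {s. a < ereal s \<and> s \<le> d}"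
  have "((G \<circ> real_of_ereal) \<longlongrightarrow> G d - (LINT s:B|lebesgue. h s)) (at_right a)"
    unfolding tendsto_at_iff_sequentially
  proof (intro allI impI)
    fix X :: "nat \<Rightarrow> ereal" assume X: "\<forall>i. X i \<in> {a<..} - {a}" and lim: "X \<longlonglongrightarrow> a"
    \<comment> \<open>The set is empty while \<open>X n\<close> exceeds \<open>d\<close>; only large
      \<open>n\<close> matter, where it is a compact interval.\<close>
    define A where "A n = {s. X n \<le> ereal s \<and> s \<le> d}" for n
    have T: "A n \<subseteq> einterval a c" "B \<subseteq> einterval a c" for n
      using less_le_trans[of a "X n"] X d(2) by (auto simp: A_def B_def einterval_iff)
    have meas: "A n \<in> sets lebesgue" "B \<in> sets lebesgue" for n
    proof -
      have "A n \<in> sets borel" "B \<in> sets borel" unfolding A_def B_def by measurable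
      then show "A n \<in> sets lebesgue" "B \<in> sets lebesgue" by auto
    qed
    have "(\<lambda>n. LINT s:A n|lebesgue. h s) \<longlonglongrightarrow> (LINT s:B|lebesgue. h s)"
    proof (rule set_integral_tendsto_sets[OF h])
      fix s show "\<forall>\<^sub>F n in sequentially. s \<in> A n \<longleftrightarrow> s \<in> B"
      proof (cases "a < ereal s")
        case True
        from order_tendstoD(2)[OF lim this] show ?thesis
          by eventually_elim (use True in \<open>auto simp: A_def B_def\<close>)
      next
        case False
        then have "s \<notin> A n" for n using T(1)[of n] by (auto simp: einterval_iff)
        with False show ?thesis by (simp add: B_def)
      qed
    qed (use T meas in auto)
    then have "(\<lambda>n. G d - (LINT s:A n|lebesgue. h s)) \<longlonglongrightarrow> G d - (LINT s:B|lebesgue. h s)"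
      by (intro tendsto_intros)
    moreover have "\<forall>\<^sub>F n in sequentially. G d - (LINT s:A n|lebesgue. h s) = (G \<circ> real_of_ereal \<circ> X) n"
      using order_tendstoD(2)[OF lim d(1)]
    proof eventually_elim
      \<comment> \<open>Lying strictly between \<open>a\<close> and \<open>d\<close>, the value
        \<open>X n\<close> is finite, so \<open>real_of_ereal\<close> loses nothing.\<close>
      fix n assume n: "X n < ereal d"
      obtain x where x: "X n = ereal x"
        using n X by (cases "X n") (auto dest: spec[of _ n])
      have "A n = {x..d}" by (auto simp: A_def x)
      moreover have "a < ereal x" using X x by (metis DiffD1 greaterThan_iff)
      ultimately have "(h has_integral (G d - G x)) (A n)" using G[of x d] n x d by simp
      moreover have "(h has_integral (LINT s:A n|lebesgue. h s)) (A n)"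
        by (intro has_integral_set_lebesgue set_integrable_subset[OF h] meas T)
      ultimately have "G d - G x = (LINT s:A n|lebesgue. h s)" by (rule has_integral_unique)
      then show "G d - (LINT s:A n|lebesgue. h s) = (G \<circ> real_of_ereal \<circ> X) n"
        by (simp add: x algebra_simps)
    qed
    ultimately show "((G \<circ> real_of_ereal) \<circ> X) \<longlonglongrightarrow> G d - (LINT s:B|lebesgue. h s)"
      by (rule Lim_transform_eventually)
  qed
  then show ?thesis by (auto simp: filterlim_filtermap comp_def)
qed

text \<open>Mirror image of \<open>primitive_tendsto_left\<close>: here \<open>G y\<close> is
  \<open>G d\<close> plus the integral of \<open>h\<close> over \<open>[d, y]\<close>.\<close>

lemma primitive_tendsto_right:
  fixes G h :: "real \<Rightarrow> complex"
  assumes c: "c \<in> einterval a b" and h: "set_integrable lebesgue (einterval c b) h"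
    and G: "\<And>x y. \<lbrakk>a < ereal x; x \<le> y; ereal y < b\<rbrakk> \<Longrightarrow> (h has_integral (G y - G x)) {x..y}"
  shows "\<exists>L. (G \<longlongrightarrow> L) (filtermap real_of_ereal (at_left b))"
proof -
  obtain d where d: "ereal d < b" "ereal c < ereal d" "a < ereal d"
  proof -
    have "a < ereal c" "ereal c < b" using c by (auto simp: einterval_iff)
    then obtain d where "ereal d < b" "ereal c < ereal d" using ereal_dense2 by blast
    with \<open>a < ereal c\<close> show ?thesis using that less_trans by blast
  qed
  define B where "B = {s. d \<le> s \<and> ereal s < b}"
  have "((G \<circ> real_of_ereal) \<longlongrightarrow> G d + (LINT s:B|lebesgue. h s)) (at_left b)"
    unfolding tendsto_at_iff_sequentially
  proof (intro allI impI)
    fix X :: "nat \<Rightarrow> ereal" assume X: "\<forall>i. X i \<in> {..<b} - {b}" and lim: "X \<longlonglongrightarrow> b"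
    define A where "A n = {s. d \<le> s \<and> ereal s \<le> X n}" for n
    have T: "A n \<subseteq> einterval c b" "B \<subseteq> einterval c b" for n
      using le_less_trans[of _ "X n" b] X d(2) by (auto simp: A_def B_def einterval_iff)
    have meas: "A n \<in> sets lebesgue" "B \<in> sets lebesgue" for n
    proof -
      have "A n \<in> sets borel" "B \<in> sets borel" unfolding A_def B_def by measurable
      then show "A n \<in> sets lebesgue" "B \<in> sets lebesgue" by auto
    qed
    have "(\<lambda>n. LINT s:A n|lebesgue. h s) \<longlonglongrightarrow> (LINT s:B|lebesgue. h s)"
    proof (rule set_integral_tendsto_sets[OF h])
      fix s show "\<forall>\<^sub>F n in sequentially. s \<in> A n \<longleftrightarrow> s \<in> B"
      proof (cases "ereal s < b")
        case True
        from order_tendstoD(1)[OF lim this] show ?thesis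
          by eventually_elim (use True in \<open>auto simp: A_def B_def\<close>)
      next
        case False
        then have "s \<notin> A n" for n using T(1)[of n] by (auto simp: einterval_iff)
        with False show ?thesis by (simp add: B_def)
      qed
    qed (use T meas in auto)
    then have "(\<lambda>n. G d + (LINT s:A n|lebesgue. h s)) \<longlonglongrightarrow> G d + (LINT s:B|lebesgue. h s)"
      by (intro tendsto_intros)
    moreover have "\<forall>\<^sub>F n in sequentially. G d + (LINT s:A n|lebesgue. h s) = (G \<circ> real_of_ereal \<circ> X) n"
      using order_tendstoD(1)[OF lim d(1)]
    proof eventually_elim
      fix n assume n: "ereal d < X n"
      obtain x where x: "X n = ereal x"
        using n X by (cases "X n") (auto dest: spec[of _ n])
      have "A n = {d..x}" by (auto simp: A_def x)
      moreover have "ereal x < b" using X x by (metis DiffD1 lessThan_iff)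
      ultimately have "(h has_integral (G x - G d)) (A n)" using G[of d x] n x d by simp
      moreover have "(h has_integral (LINT s:A n|lebesgue. h s)) (A n)"
        by (intro has_integral_set_lebesgue set_integrable_subset[OF h] meas T)
      ultimately have "G x - G d = (LINT s:A n|lebesgue. h s)" by (rule has_integral_unique)
      then show "G d + (LINT s:A n|lebesgue. h s) = (G \<circ> real_of_ereal \<circ> X) n"
        by (simp add: x algebra_simps)
    qed
    ultimately show "((G \<circ> real_of_ereal) \<circ> X) \<longlonglongrightarrow> G d + (LINT s:B|lebesgue. h s)"
      by (rule Lim_transform_eventually)
  qed
  then show ?thesis by (auto simp: filterlim_filtermap comp_def)
qed

lemma sq_integrable_on_subset:
  assumes "sq_integrable_on S A f" "B \<in> sets lebesgue" "B \<subseteq> A"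
  shows "sq_integrable_on S B f"
  using assms set_borel_measurable_subset[of lebesgue A f B] set_integrable_subset[of lebesgue A _ B]
  unfolding sq_integrable_on_def by blast

lemma eigenspaceD:
  assumes "f \<in> eigenspace S z"
  shows "regular_fun S f" "sq_integrable_on S (dom_interval S) f"
    "ae_on (dom_interval S) (\<lambda>x. sl_expr S f x = z * f x)"
  using assms by (auto simp: eigenspace_def D_max_def L2_def)

lemma real_solutionD:
  assumes "real_solution S \<mu> u"
  shows "sl_solution S (complex_of_real \<mu>) (cplx u)" "regular_fun S (cplx u)"
    "ae_on (dom_interval S) (\<lambda>x. sl_expr S (cplx u) x = complex_of_real \<mu> * cplx u x)"
  using assms by (auto simp: real_solution_def sl_solution_def)

text \<open>The limit-circle hypothesis makes \<open>u\<close> square integrable near the endpoint,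
  and \<open>f\<close> is so on the whole interval. Hence the Lagrange integrand is integrable there
  and its primitive, the bracket, converges.\<close>

lemma bracket_left_convergent:
  assumes S: "sl_coefficients S" and lc: "limit_circle_left S"
    and f: "f \<in> eigenspace S z" and u: "real_solution S \<mu> u"
  shows "\<exists>L. (bracket S f (cplx u) \<longlongrightarrow> L) (filtermap real_of_ereal (at_right (left_end S)))"
proof -
  obtain c where c: "c \<in> dom_interval S" "sq_integrable_on S (einterval (left_end S) c) (cplx u)"
    using lc real_solutionD(1)[OF u] unfolding limit_circle_left_def by blast
  have sub: "einterval (left_end S) c \<subseteq> dom_interval S"
    using c(1) less_trans[of "ereal x" "ereal c" "right_end S" for x] by (auto simp: einterval_iff)
  have "set_integrable lebesgue (einterval (left_end S) c)
      (\<lambda>s. (z - cnj \<mu>) * (coeff_w S s * (f s * cnj (cplx u s))))"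
    by (intro set_integrable_mult_right sq_integrable_on_mult_cnj S c(2) sub
        sq_integrable_on_subset[OF eigenspaceD(2)[OF f]]) auto
  then show ?thesis
    by (rule primitive_tendsto_left[OF c(1)])
      (rule lagrange_identity[OF S eigenspaceD(1)[OF f] real_solutionD(2)[OF u] eigenspaceD(3)[OF f] real_solutionD(3)[OF u]])
qed

lemma bracket_right_convergent:
  assumes S: "sl_coefficients S" and lc: "limit_circle_right S"
    and f: "f \<in> eigenspace S z" and u: "real_solution S \<mu> u"
  shows "\<exists>L. (bracket S f (cplx u) \<longlongrightarrow> L) (filtermap real_of_ereal (at_left (right_end S)))"
proof -
  obtain c where c: "c \<in> dom_interval S" "sq_integrable_on S (einterval c (right_end S)) (cplx u)"
    using lc real_solutionD(1)[OF u] unfolding limit_circle_right_def by blast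
  have sub: "einterval c (right_end S) \<subseteq> dom_interval S"
    using c(1) less_trans[of "left_end S" "ereal c" "ereal x" for x] by (auto simp: einterval_iff)
  have "set_integrable lebesgue (einterval c (right_end S))
      (\<lambda>s. (z - cnj \<mu>) * (coeff_w S s * (f s * cnj (cplx u s))))"
    by (intro set_integrable_mult_right sq_integrable_on_mult_cnj S c(2) sub
        sq_integrable_on_subset[OF eigenspaceD(2)[OF f]]) auto
  then show ?thesis
    by (rule primitive_tendsto_right[OF c(1)])
      (rule lagrange_identity[OF S eigenspaceD(1)[OF f] real_solutionD(2)[OF u] eigenspaceD(3)[OF f] real_solutionD(3)[OF u]])
qed

section \<open>Linearity and vanishing of the boundary limits\<close>

text \<open>The endpoint filters are proper, so that limits are unique and \<open>Lim\<close> is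
  determined, and they concentrate on the interval, where the pointwise identities for brackets
  hold.\<close>

lemma einterval_end_filters:
  assumes "a < b"
  shows "\<forall>\<^sub>F x in filtermap real_of_ereal (at_right a). x \<in> einterval a b"
    and "\<forall>\<^sub>F x in filtermap real_of_ereal (at_left b). x \<in> einterval a b"
    and "filtermap real_of_ereal (at_right a) \<noteq> bot"
    and "filtermap real_of_ereal (at_left b) \<noteq> bot"
proof -
  \<comment> \<open>Points strictly between \<open>a\<close> and \<open>b\<close> are finite, so the
    default value of \<open>real_of_ereal\<close> at the infinities does not interfere.\<close>
  have in_einterval: "real_of_ereal y \<in> einterval a b" if "a < y" "y < b" for y
    using that by (cases y) (auto simp: einterval_iff)
  then show "\<forall>\<^sub>F x in filtermap real_of_ereal (at_right a). x \<in> einterval a b"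
    "\<forall>\<^sub>F x in filtermap real_of_ereal (at_left b). x \<in> einterval a b"
    using assms by (auto simp: eventually_filtermap eventually_at_right eventually_at_left)
  have "at_right a \<noteq> bot" "at_left b \<noteq> bot"
    using dense[of a] dense[of _ b]
    by (auto simp: trivial_limit_def eventually_at_right[OF assms] eventually_at_left[OF assms])
  then show "filtermap real_of_ereal (at_right a) \<noteq> bot" "filtermap real_of_ereal (at_left b) \<noteq> bot"
    by (simp_all add: filtermap_bot_iff)
qed

lemma bracket_lincomb:
  assumes "regular_fun S f" "regular_fun S g" "x \<in> dom_interval S"
  shows "bracket S (\<lambda>x. \<alpha> * f x + \<beta> * g x) u x = \<alpha> * bracket S f u x + \<beta> * bracket S g u x"
  by (simp add: bracket_def pderiv_fun_lincomb[OF assms] algebra_simps)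

text \<open>\<open>Lim\<close> is meaningful only for convergent functions, hence the hypotheses
  \<open>conv\<close>; keeping the filter general serves both endpoints.\<close>

lemma Lim_bracket_lincomb:
  assumes "regular_fun S f" "regular_fun S g"
    and F: "F \<noteq> bot" "\<forall>\<^sub>F x in F. x \<in> dom_interval S"
    and conv: "\<exists>L. (bracket S f u \<longlongrightarrow> L) F" "\<exists>L. (bracket S g u \<longlongrightarrow> L) F"
  shows "Lim F (bracket S (\<lambda>x. \<alpha> * f x + \<beta> * g x) u) = \<alpha> * Lim F (bracket S f u) + \<beta> * Lim F (bracket S g u)"
proof -
  obtain L L' where L: "(bracket S f u \<longlongrightarrow> L) F" "(bracket S g u \<longlongrightarrow> L') F" using conv by blast
  have "((\<lambda>x. \<alpha> * bracket S f u x + \<beta> * bracket S g u x) \<longlongrightarrow> \<alpha> * L + \<beta> * L') F"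
    by (intro tendsto_intros L)
  moreover have "\<forall>\<^sub>F x in F. \<alpha> * bracket S f u x + \<beta> * bracket S g u x = bracket S (\<lambda>x. \<alpha> * f x + \<beta> * g x) u x"
    using F(2) by eventually_elim (simp add: bracket_lincomb assms)
  ultimately have "(bracket S (\<lambda>x. \<alpha> * f x + \<beta> * g x) u \<longlongrightarrow> \<alpha> * L + \<beta> * L') F"
    by (rule Lim_transform_eventually)
  then show ?thesis using L F(1) by (simp add: tendsto_Lim)
qed

text \<open>By continuity \<open>f\<close> vanishes on the whole interval, so its derivative does
  too; then \<open>p f'\<close> is zero almost everywhere and, again by continuity,
  everywhere.\<close>

lemma bracket_eq_0_if_AE_0:
  assumes f: "regular_fun S f" and zero: "ae_on (dom_interval S) (\<lambda>x. f x = 0)" and x: "x \<in> dom_interval S"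
  shows "bracket S f u x = 0"
proof -
  note F = is_pderiv_pderiv_fun[OF f]
  have cont: "continuous_on (dom_interval S) f" "continuous_on (dom_interval S) (pderiv_fun S f)"
    using F AC_loc_imp_continuous_on unfolding is_pderiv_def by blast+
  have f0: "f y = 0" if "y \<in> dom_interval S" for y
    by (rule ae_on_continuous_eq[OF open_einterval cont(1) continuous_on_const zero that])
  have "vector_derivative f (at y) = 0" if "y \<in> dom_interval S" for y
    by (rule vector_derivative_at, rule has_vector_derivative_transform_within_open[OF has_vector_derivative_const open_einterval that])
      (simp add: f0)
  then have "ae_on (dom_interval S) (\<lambda>y. pderiv_fun S f y = 0)"
    by (intro ae_on_mono[OF is_pderiv_ae_on[OF F]]) auto
  then have "pderiv_fun S f x = 0"
    by (rule ae_on_continuous_eq[OF open_einterval cont(2) continuous_on_const _ x])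
  with f0[OF x] show ?thesis by (simp add: bracket_def)
qed

lemma Lim_bracket_eq_0_if_AE_0:
  assumes "regular_fun S f" "ae_on (dom_interval S) (\<lambda>x. f x = 0)"
    and F: "F \<noteq> bot" "\<forall>\<^sub>F x in F. x \<in> dom_interval S"
  shows "Lim F (bracket S f u) = 0"
proof (rule tendsto_Lim[OF F(1) tendsto_eventually])
  show "\<forall>\<^sub>F x in F. bracket S f u x = 0"
    using F(2) by eventually_elim (rule bracket_eq_0_if_AE_0[OF assms(1,2)])
qed

section \<open>Eigenvalues and the matrix pencil\<close>

text \<open>Prescribing partners in \<open>R\<close> on a basis of the domain of \<open>R\<close>
  and extending linearly gives a map whose graph over that domain lies in \<open>R\<close>;
  single-valuedness at 0 leaves no other partners.\<close>

lemma linear_relation_matrix: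
  fixes R :: "(('a::field ^ 'n::finite) \<times> ('a ^ 'm::finite)) set"
  assumes add: "\<And>x y x' y'. \<lbrakk>(x, y) \<in> R; (x', y') \<in> R\<rbrakk> \<Longrightarrow> (x + x', y + y') \<in> R"
    and scale: "\<And>c x y. (x, y) \<in> R \<Longrightarrow> (c *s x, c *s y) \<in> R"
    and single_valued: "\<And>y. (0, y) \<in> R \<Longrightarrow> y = 0"
  obtains M :: "'a ^ 'n ^ 'm" where "\<And>x y. (x, y) \<in> R \<Longrightarrow> M *v x = y"
proof (cases "R = {}")
  case True
  then show ?thesis using that by blast
next
  case False
  then obtain x\<^sub>0 y\<^sub>0 where "(x\<^sub>0, y\<^sub>0) \<in> R" by fastforce
  from scale[OF this, of 0] have zero: "(0, 0) \<in> R" by simp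
  obtain B where B: "B \<subseteq> fst ` R" "vec.independent B" "fst ` R \<subseteq> vec.span B"
    using vec.maximal_independent_subset by metis
  have "\<exists>k. \<forall>b\<in>B. (b, k b) \<in> R"
    using B(1) by (intro bchoice) force
  then obtain k where k: "\<And>b. b \<in> B \<Longrightarrow> (b, k b) \<in> R" by blast
  obtain g where g: "Vector_Spaces.linear (*s) (*s) g" "\<And>b. b \<in> B \<Longrightarrow> g b = k b"
    using vec.linear_independent_extend[OF B(2), of k] by blast
  \<comment> \<open>The points at which the graph of \<open>g\<close> lies in \<open>R\<close> form
    a subspace containing \<open>B\<close>, hence the span of \<open>B\<close>.\<close>
  have "vec.subspace {x. (x, g x) \<in> R}"
    using zero add scale vec.linear_0[OF g(1)] vec.linear_add[OF g(1)] vec.linear_scale[OF g(1)]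
    by (auto simp: vec.subspace_def)
  then have graph: "(x, g x) \<in> R" if "x \<in> vec.span B" for x
    using vec.span_induct[OF that, of "\<lambda>x. (x, g x) \<in> R"] k g(2) by force
  show ?thesis
  proof (rule that[of "matrix g"])
    fix x y assume xy: "(x, y) \<in> R"
    then have "(x, g x) \<in> R" using graph B(3) by force
    \<comment> \<open>Subtracting the two pairs over \<open>x\<close> gives a pair with first
      component 0.\<close>
    from add[OF xy scale[OF this, of "-1"]] have "y - g x = 0"
      by (intro single_valued) simp
    then show "matrix g *v x = y" using matrix_works[OF g(1)] by simp
  qed
qed

lemma det_eq_0_if_kernel:
  fixes A :: "'a::field ^ 'n::finite ^ 'n"
  assumes "A *v x = 0" "x \<noteq> 0"
  shows "det A = 0"
  using assms invertible_det_nz[of A] matrix_left_invertible_ker[of A] invertible_left_inverse[of A] by blast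

text \<open>For 2 by 2 matrices the determinant is quadratic in \<open>t\<close>, with constant term
  \<open>det A\<close> and leading coefficient \<open>det B\<close>; the real parameters inject into
  its at most two complex roots.\<close>

lemma card_roots_det_pencil:
  fixes A B :: "complex ^ 2 ^ 2"
  assumes "det B \<noteq> 0"
  shows "finite {t :: real. det (A + t *\<^sub>R B) = 0} \<and> card {t :: real. det (A + t *\<^sub>R B) = 0} \<le> 2"
proof -
  define p where "p = [:det A, A$1$1 * B$2$2 + B$1$1 * A$2$2 - A$1$2 * B$2$1 - B$1$2 * A$2$1, det B:]"
  have p: "p \<noteq> 0" "degree p = 2" using assms by (auto simp: p_def)
  have "det (A + t *\<^sub>R B) = poly p (of_real t)" for t
    by (simp add: det_2 p_def scaleR_conv_of_real[where 'a=complex] algebra_simps)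
  then have sub: "of_real ` {t :: real. det (A + t *\<^sub>R B) = 0} \<subseteq> {x. poly p x = 0}" by auto
  have inj: "inj_on of_real {t :: real. det (A + t *\<^sub>R B) = 0}"
    by (rule inj_onI) (simp only: of_real_eq_iff)
  show ?thesis
    using inj_on_finite[OF inj sub poly_roots_finite[OF p(1)]]
      card_inj_on_le[OF inj sub poly_roots_finite[OF p(1)]] card_poly_roots_bound[OF p(1)] p(2) by simp
qed

theorem theorem4p6:
  fixes S :: sl_data
    and K \<mu> :: real
    and ua va ub vb :: "real \<Rightarrow> real"
    and \<theta>' \<theta> :: "complex ^ 2 ^ 2"
    and z :: complex
  assumes "sl_coefficients S"
    and "limit_circle_left S"
    and "limit_circle_right S"
    and "L_min_bounded_below S K"
    and "principal_left S \<mu> ua"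
    and "nonprincipal_left S \<mu> va"
    and "bracket_left S (cplx ua) (cplx va) = 1"
    and "principal_right S \<mu> ub"
    and "nonprincipal_right S \<mu> vb"
    and "bracket_right S (cplx ub) (cplx vb) = 1"
    and "\<theta>' \<in> hermitian_matrices"
    and "\<theta> \<in> hermitian_matrices"
    and "det \<theta> \<noteq> 0"
    and "z \<in> resolvent_set S (D_inf S ua ub)"
  shows "finite {t :: real. is_eigenvalue S (D_ext S ua va ub vb (\<theta>' + t *\<^sub>R \<theta>)) z} \<and>
         card {t :: real. is_eigenvalue S (D_ext S ua va ub vb (\<theta>' + t *\<^sub>R \<theta>)) z} \<le> 2"
proof -
  note S = assms(1)
  have "left_end S < right_end S" using S by (simp add: sl_coefficients_def)
  note ends = einterval_end_filters[OF this]
  have sol: "real_solution S \<mu> ua" "real_solution S \<mu> va" "real_solution S \<mu> ub" "real_solution S \<mu> vb"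
    using assms by (auto simp: principal_left_def nonprincipal_left_def principal_right_def nonprincipal_right_def)
  define E where "E = eigenspace S z"
  define \<Gamma>0 where "\<Gamma>0 = Gamma0' S ua ub"
  define \<Gamma>1 where "\<Gamma>1 = Gamma1' S va vb"
  note Gamma_defs = \<Gamma>0_def \<Gamma>1_def Gamma0'_def Gamma1'_def qd0_left_def qd1_left_def qd0_right_def qd1_right_def
  have lincomb: "\<Gamma>0 (\<lambda>x. \<alpha> * f x + \<beta> * g x) = \<alpha> *s \<Gamma>0 f + \<beta> *s \<Gamma>0 g"
    "\<Gamma>1 (\<lambda>x. \<alpha> * f x + \<beta> * g x) = \<alpha> *s \<Gamma>1 f + \<beta> *s \<Gamma>1 g"
    if fg: "f \<in> E" "g \<in> E" for f g \<alpha> \<beta>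
  proof -
    note fg = fg[unfolded E_def]
    have "bracket_left S (\<lambda>x. \<alpha> * f x + \<beta> * g x) (cplx u) = \<alpha> * bracket_left S f (cplx u) + \<beta> * bracket_left S g (cplx u)"
      if u: "real_solution S \<mu> u" for u
      unfolding bracket_left_def
      by (rule Lim_bracket_lincomb[OF eigenspaceD(1)[OF fg(1)] eigenspaceD(1)[OF fg(2)] ends(3,1)
            bracket_left_convergent[OF S assms(2) fg(1) u] bracket_left_convergent[OF S assms(2) fg(2) u]])
    moreover have "bracket_right S (\<lambda>x. \<alpha> * f x + \<beta> * g x) (cplx u) = \<alpha> * bracket_right S f (cplx u) + \<beta> * bracket_right S g (cplx u)"
      if u: "real_solution S \<mu> u" for u
      unfolding bracket_right_def
      by (rule Lim_bracket_lincomb[OF eigenspaceD(1)[OF fg(1)] eigenspaceD(1)[OF fg(2)] ends(4,2)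
            bracket_right_convergent[OF S assms(3) fg(1) u] bracket_right_convergent[OF S assms(3) fg(2) u]])
    ultimately show "\<Gamma>0 (\<lambda>x. \<alpha> * f x + \<beta> * g x) = \<alpha> *s \<Gamma>0 f + \<beta> *s \<Gamma>0 g"
      "\<Gamma>1 (\<lambda>x. \<alpha> * f x + \<beta> * g x) = \<alpha> *s \<Gamma>1 f + \<beta> *s \<Gamma>1 g"
      using sol by (simp_all add: Gamma_defs vec_eq_iff forall_2 vector_2)
  qed
  \<comment> \<open>The components of \<open>\<Gamma>0 f\<close> are, up to sign, the two boundary
    values that define \<open>D_inf\<close>.\<close>
  have ker: "ae_on (dom_interval S) (\<lambda>x. f x = 0)" if f: "f \<in> E" and 0: "\<Gamma>0 f = 0" for f
  proof -
    have "\<Gamma>0 f $ 1 = 0" "\<Gamma>0 f $ 2 = 0" using 0 by simp_all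
    then have "f \<in> D_inf S ua ub"
      using f by (simp add: Gamma_defs vector_2 D_inf_def E_def eigenspace_def)
    moreover have "ae_on (dom_interval S) (\<lambda>x. sl_expr S f x - z * f x = 0)"
      using eigenspaceD(3)[OF f[unfolded E_def]] by simp
    ultimately show ?thesis
      using assms(14) unfolding resolvent_set_def by blast
  qed
  \<comment> \<open>Such an \<open>f\<close> is null, so all its brackets vanish inside the interval
    and hence in the limit.\<close>
  have single: "\<Gamma>1 f = 0" if f: "f \<in> E" and 0: "\<Gamma>0 f = 0" for f
    using Lim_bracket_eq_0_if_AE_0[OF eigenspaceD(1)[OF f[unfolded E_def]] ker[OF f 0] ends(3,1)]
      Lim_bracket_eq_0_if_AE_0[OF eigenspaceD(1)[OF f[unfolded E_def]] ker[OF f 0] ends(4,2)]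
    by (simp add: Gamma_defs bracket_left_def bracket_right_def vec_eq_iff forall_2 vector_2)
  have E: "(\<lambda>x. \<alpha> * f x + \<beta> * g x) \<in> E" if "f \<in> E" "g \<in> E" for f g \<alpha> \<beta>
    using eigenspace_lincomb[OF S] that unfolding E_def by blast
  \<comment> \<open>On the boundary data of the eigenspace \<open>M\<close> acts as the Weyl
    function at \<open>z\<close>, sending \<open>\<Gamma>0 f\<close> to
    \<open>\<Gamma>1 f\<close>.\<close>
  obtain M where M: "\<And>x y. (x, y) \<in> (\<lambda>f. (\<Gamma>0 f, \<Gamma>1 f)) ` E \<Longrightarrow> M *v x = y"
  proof (rule linear_relation_matrix[of "(\<lambda>f. (\<Gamma>0 f, \<Gamma>1 f)) ` E"])
    fix x y x' y' assume "(x, y) \<in> (\<lambda>f. (\<Gamma>0 f, \<Gamma>1 f)) ` E" "(x', y') \<in> (\<lambda>f. (\<Gamma>0 f, \<Gamma>1 f)) ` E"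
    then obtain f g where fg: "f \<in> E" "g \<in> E" and "x = \<Gamma>0 f" "y = \<Gamma>1 f" "x' = \<Gamma>0 g" "y' = \<Gamma>1 g" by auto
    then show "(x + x', y + y') \<in> (\<lambda>f. (\<Gamma>0 f, \<Gamma>1 f)) ` E"
      using lincomb[OF fg, of 1 1] E[OF fg, of 1 1] by (intro image_eqI[of _ _ "\<lambda>x. 1 * f x + 1 * g x"]) simp_all
  next
    fix c x y assume "(x, y) \<in> (\<lambda>f. (\<Gamma>0 f, \<Gamma>1 f)) ` E"
    then obtain f where f: "f \<in> E" and "x = \<Gamma>0 f" "y = \<Gamma>1 f" by auto
    \<comment> \<open>A scalar multiple is treated as a combination of \<open>f\<close> with itself,
      the second coefficient being 0.\<close>
    then show "(c *s x, c *s y) \<in> (\<lambda>f. (\<Gamma>0 f, \<Gamma>1 f)) ` E"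
      using lincomb[OF f f, of c 0] E[OF f f, of c 0] by (intro image_eqI[of _ _ "\<lambda>x. c * f x + 0 * f x"]) simp_all
  next
    fix y assume "(0, y) \<in> (\<lambda>f. (\<Gamma>0 f, \<Gamma>1 f)) ` E"
    then show "y = 0" using single by auto
  qed blast
  let ?T = "{t :: real. is_eigenvalue S (D_ext S ua va ub vb (\<theta>' + t *\<^sub>R \<theta>)) z}"
  have sub: "?T \<subseteq> {t. det ((\<theta>' - M) + t *\<^sub>R \<theta>) = 0}"
  proof clarify
    fix t assume "is_eigenvalue S (D_ext S ua va ub vb (\<theta>' + t *\<^sub>R \<theta>)) z"
    then obtain f where f: "f \<in> E" "(\<theta>' + t *\<^sub>R \<theta>) *v \<Gamma>0 f = \<Gamma>1 f"
      "\<not> ae_on (dom_interval S) (\<lambda>x. f x = 0)"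
      unfolding is_eigenvalue_def D_ext_def E_def eigenspace_def \<Gamma>0_def \<Gamma>1_def by blast
    have "M *v \<Gamma>0 f = \<Gamma>1 f" using f(1) by (intro M) blast
    moreover have "(\<theta>' - M) + t *\<^sub>R \<theta> = (\<theta>' + t *\<^sub>R \<theta>) - M" by simp
    ultimately have "((\<theta>' - M) + t *\<^sub>R \<theta>) *v \<Gamma>0 f = 0"
      using f(2) by (simp only: matrix_vector_mult_diff_rdistrib) simp
    \<comment> \<open>The eigenfunction is not null, so \<open>ker\<close> excludes
      \<open>\<Gamma>0 f = 0\<close> and the kernel vector is nonzero.\<close>
    then show "det ((\<theta>' - M) + t *\<^sub>R \<theta>) = 0"
      using det_eq_0_if_kernel ker f(1,3) by blast
  qed
  then show ?thesis
    using card_roots_det_pencil[OF assms(13), of "\<theta>' - M"] finite_subset[OF sub] card_mono[OF _ sub] by auto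
qed

end
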